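(* Let $\mu\in\mathrm{Dyck}(2n)$. The map $\psi$ is a bijection from $\mathcal D( */\mu)$ to $\mathcal{HH}(\mu)$, and if $\psi(T)=(\mu,H)$ then $|T|=\|H\|$. Consequently $\zeta^{-1}\circ\psi:\mathcal D( */\mu)\to\mathcal M(\mu)$ is a bijection such that if $(\zeta^{-1}\circ\psi)(T)=\pi$ then $|T|=\mathrm{cr}(\pi)$.
   Context: A Dyck path of length $2n$ is a lattice path from $(0,0)$ to $(n,n)$ with up steps $(0,1)$ and down steps $(1,0)$ never going below $y=x$; $\mathrm{Dyck}(2n)$ is their set. For $\lambda,\mu\in\mathrm{Dyck}(2n)$ with $\mu$ weakly above $\lambda$, $\lambda/\mu$ is the set of unit cells between them. A Dyck tile is an edge-connected skew shape with no $2\times2$ block whose cell centers, joined by unit up/right moves, form a translated Dyck path. A (cover-inclusive) Dyck tiling of $\lambda/\mu$ is a partition of its cells into Dyck tiles such that whenever a tile $T_1$ contains the $(1,-1)$-translate of a cell of tile $T_2$, $T_2+(1,-1)\subseteq T_1$; $\mathcal D(\lambda/\mu)$ is their set (empty if $\mu$ is not weakly above $\lambda$), $|T|$ the number of tiles, and $\mathcal D( */\mu)=\bigcup_{\nu\in\mathrm{Dyck}(2n)}\mathcal D(\nu/\mu)$. The entry (resp. exit) of a Dyck tile is the north edge of its northeast cell (resp. the south edge of its southwest cell). Chords: up and down steps of a Dyck path are matched like parentheses; a matched pair is a chord; if the up step of chord $c$ starts at $(x_1,y_1)$, $\mathrm{ht}(c)=y_1-x_1+1$; the height of a down step is the height of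 its chord. A Hermite history with Dyck path $\mu$ is a labeling $H$ of the down steps of $\mu$ with a down step of height $h$ labeled in $\{0,\dots,h-1\}$; $\mathcal{HH}(\mu)$ is the set of pairs $(\mu,H)$, and $\|H\|$ is the sum of labels. The map $\psi$: for $T\in\mathcal D(\nu/\mu)$, $\psi(T)=(\mu,H)$ where the label of a down step $s$ of $\mu$ (a horizontal unit edge) is the number $k\ge0$ defined by: $e_0=s$; while $e_{j}$ is the entry of a tile of $T$, let $e_{j+1}$ be the exit of that tile; $k$ is the index at which $e_k$ is not the entry of any tile (i.e., travel south from $s$, jumping from each entry reached to the corresponding exit, and count the tiles passed). Matchings: a complete matching on $[2n]$ is a set of pairs $(i,j)$, $i<j$, covering each element of $[2n]$ once; its shape is the Dyck path whose $k$-th step is up iff $k$ is the smaller element of its pair; $\mathcal M(\mu)$ is the set of matchings with shape $\mu$; $\mathrm{cr}(\pi)=\#\{\{(i,j),(i',j')\}\subseteq\pi: i<i'<j<j'\}$. $\zeta:\mathcal M(\mu)\to\mathcal{HH}(\mu)$ is the bijection sending $\pi$ to $(\mu,H)$ where the $j$-th step (a down step, $(i,j)\in\pi$) gets label $\#\{(i',j')\in\pi:i<i'<j<j'\}$. *)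

theory Defs
  imports Main
begin

text \<open>A Dyck path is a list of booleans, True = up step (0,1), False = down step (1,0).
  Step number j (0-based list index) starts at the lattice point
  (number of down steps before it, number of up steps before it).\<close>

definition ups :: "bool list \<Rightarrow> nat" where
  "ups xs = length (filter id xs)"

definition downs :: "bool list \<Rightarrow> nat" where
  "downs xs = length (filter Not xs)"

definition dyck_word :: "bool list \<Rightarrow> bool" where
  "dyck_word w \<longleftrightarrow> ups w = downs w \<and> (\<forall>k \<le> length w. downs (take k w) \<le> ups (take k w))"

definition dyck_paths :: "nat \<Rightarrow> bool list set" where
  "dyck_paths n = {w. length w = 2 * n \<and> dyck_word w}"

type_synonym cell = "int \<times> int"

definition step_start :: "bool list \<Rightarrow> nat \<Rightarrow> int \<times> int" where
  "step_start p j = (int (downs (take j p)), int (ups (take j p)))"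

definition down_steps :: "bool list \<Rightarrow> nat set" where
  "down_steps p = {j. j < length p \<and> \<not> p ! j}"

definition col_height :: "bool list \<Rightarrow> int \<Rightarrow> int" where
  "col_height p x = (THE y. \<exists>j\<in>down_steps p. step_start p j = (x, y))"

definition weakly_above :: "bool list \<Rightarrow> bool list \<Rightarrow> bool" where
  "weakly_above \<mu> lam \<longleftrightarrow> length lam = length \<mu> \<and>
     (\<forall>x. 0 \<le> x \<and> x < int (length \<mu> div 2) \<longrightarrow> col_height lam x \<le> col_height \<mu> x)"

text \<open>Cells (indexed by lower-left corner) between lam (below) and \<mu> (above).\<close>
definition skew_cells :: "bool list \<Rightarrow> bool list \<Rightarrow> cell set" where
  "skew_cells lam \<mu> = {(x, y). 0 \<le> x \<and> x < int (length \<mu> div 2) \<and>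
       col_height lam x \<le> y \<and> y < col_height \<mu> x}"

fun path_cells :: "cell \<Rightarrow> bool list \<Rightarrow> cell list" where
  "path_cells c [] = [c]"
| "path_cells (x, y) (b # w) = (x, y) # path_cells (if b then (x, y + 1) else (x + 1, y)) w"

text \<open>A Dyck tile: its cell centers, joined by unit up/right moves, form a translated Dyck path.
  (Such a set is automatically an edge-connected skew shape without 2x2 block.)\<close>
definition dyck_tile :: "cell set \<Rightarrow> bool" where
  "dyck_tile T \<longleftrightarrow> (\<exists>c w. dyck_word w \<and> T = set (path_cells c w))"

definition shift :: "cell \<Rightarrow> cell" where
  "shift c = (fst c + 1, snd c - 1)"

definition cover_inclusive :: "cell set set \<Rightarrow> bool" where
  "cover_inclusive P \<longleftrightarrow>
     (\<forall>T1\<in>P. \<forall>T2\<in>P. (\<exists>c\<in>T2. shift c \<in> T1) \<longrightarrow> shift ` T2 \<subseteq> T1)"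

definition dyck_tilings :: "bool list \<Rightarrow> bool list \<Rightarrow> cell set set set" where
  "dyck_tilings lam \<mu> =
     (if weakly_above \<mu> lam then
        {P. \<Union>P = skew_cells lam \<mu> \<and> (\<forall>T\<in>P. dyck_tile T) \<and>
            (\<forall>T1\<in>P. \<forall>T2\<in>P. T1 \<noteq> T2 \<longrightarrow> T1 \<inter> T2 = {}) \<and> cover_inclusive P}
      else {})"

definition tilings_star :: "bool list \<Rightarrow> cell set set set" where
  "tilings_star \<mu> = (\<Union>\<nu>\<in>dyck_paths (length \<mu> div 2). dyck_tilings \<nu> \<mu>)"

definition chord :: "bool list \<Rightarrow> nat \<Rightarrow> nat \<Rightarrow> bool" where
  "chord p i j \<longleftrightarrow> i < j \<and> j < length p \<and> p ! i \<and> \<not> p ! j \<and>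
     dyck_word (take (j - i - 1) (drop (i + 1) p))"

definition ht :: "bool list \<Rightarrow> nat \<Rightarrow> nat" where
  "ht p j = (let i = (THE i. chord p i j) in ups (take i p) + 1 - downs (take i p))"

text \<open>Hermite histories: labels of down steps (indexed by position in the list),
  extended by 0 off the down steps.\<close>
definition HH :: "bool list \<Rightarrow> (bool list \<times> (nat \<Rightarrow> nat)) set" where
  "HH \<mu> = {(\<mu>, H) | H. (\<forall>j\<in>down_steps \<mu>. H j < ht \<mu> j) \<and> (\<forall>j. j \<notin> down_steps \<mu> \<longrightarrow> H j = 0)}"

definition hh_norm :: "bool list \<Rightarrow> (nat \<Rightarrow> nat) \<Rightarrow> nat" where
  "hh_norm \<mu> H = (\<Sum>j\<in>down_steps \<mu>. H j)"

text \<open>A horizontal unit edge from (x,y) to (x+1,y) is represented by (x,y).\<close>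
definition ne_cell :: "cell set \<Rightarrow> cell" where
  "ne_cell T = (Max (fst ` T), Max (snd ` T))"

definition sw_cell :: "cell set \<Rightarrow> cell" where
  "sw_cell T = (Min (fst ` T), Min (snd ` T))"

text \<open>Entry: north edge of the northeast cell; exit: south edge of the southwest cell.\<close>
definition entry :: "cell set \<Rightarrow> int \<times> int" where
  "entry T = (fst (ne_cell T), snd (ne_cell T) + 1)"

definition exit :: "cell set \<Rightarrow> int \<times> int" where
  "exit T = sw_cell T"

definition next_edge :: "cell set set \<Rightarrow> int \<times> int \<Rightarrow> int \<times> int" where
  "next_edge P e = exit (THE T. T \<in> P \<and> entry T = e)"

definition psi_label :: "cell set set \<Rightarrow> int \<times> int \<Rightarrow> nat" where
  "psi_label P e = (LEAST k. \<not> (\<exists>T\<in>P. entry T = (next_edge P ^^ k) e))"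

definition psi :: "bool list \<Rightarrow> cell set set \<Rightarrow> bool list \<times> (nat \<Rightarrow> nat)" where
  "psi \<mu> P = (\<mu>, \<lambda>j. if j \<in> down_steps \<mu> then psi_label P (step_start \<mu> j) else 0)"

definition complete_matching :: "nat \<Rightarrow> (nat \<times> nat) set \<Rightarrow> bool" where
  "complete_matching n \<pi> \<longleftrightarrow>
     (\<forall>(i, j)\<in>\<pi>. 1 \<le> i \<and> i < j \<and> j \<le> 2 * n) \<and>
     (\<forall>k\<in>{1..2 * n}. \<exists>!p. p \<in> \<pi> \<and> (fst p = k \<or> snd p = k))"

text \<open>Shape: the k-th step (1-based, list index k-1) is up iff k is the smaller element of its pair.\<close>
definition shape :: "nat \<Rightarrow> (nat \<times> nat) set \<Rightarrow> bool list" where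
  "shape n \<pi> = map (\<lambda>k. \<exists>j. (k, j) \<in> \<pi>) [1..<2 * n + 1]"

definition matchings :: "bool list \<Rightarrow> (nat \<times> nat) set set" where
  "matchings \<mu> = {\<pi>. complete_matching (length \<mu> div 2) \<pi> \<and> shape (length \<mu> div 2) \<pi> = \<mu>}"

definition cr :: "(nat \<times> nat) set \<Rightarrow> nat" where
  "cr \<pi> = card {{p, q} | p q. p \<in> \<pi> \<and> q \<in> \<pi> \<and> fst p < fst q \<and> fst q < snd p \<and> snd p < snd q}"

text \<open>zeta: the down step with list index k (the (k+1)-th step, (i,k+1) in \<pi>) gets label
  #{(i',j') in \<pi>. i < i' < k+1 < j'}.\<close>
definition zeta :: "bool list \<Rightarrow> (nat \<times> nat) set \<Rightarrow> bool list \<times> (nat \<Rightarrow> nat)" where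
  "zeta \<mu> \<pi> = (\<mu>, \<lambda>k. if k \<in> down_steps \<mu> then
       card {(i', j') \<in> \<pi>. \<exists>i. (i, k + 1) \<in> \<pi> \<and> i < i' \<and> i' < k + 1 \<and> k + 1 < j'}
     else 0)"

end

theory Submission
  imports Defs
begin

text \<open>A tile has at most one cell on each antidiagonal \<open>x + y = const\<close>, and cover-inclusiveness says
  that a tile lying above another one (on some common antidiagonal) is, up to a translation along
  the antidiagonals, part of it. Hence a tile edge-adjacent to another one is either nested with it
  or touches it entry to exit, so every tile belongs to exactly one chain of entries and exits
  starting at a down step of \<open>\<mu>\<close>. This gives \<open>|T| = \<parallel>H\<parallel>\<close>, and since each jump lowers
  the height of the edge by one, the labels are smaller than the heights.

  Injectivity: chains do not cross, so a tile whose left neighbour (or the tile covering it) is a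
  different tile sits on a chain starting further to the right. Comparing two tilings with the same
  labels chain by chain, from left to right and from top to bottom, corresponding tiles have the same
  entry and, walking to the left from there, cannot part.

  Surjectivity: adding a tile below a lower path \<open>\<nu>\<close> amounts to exchanging the two steps of a
  chord of \<open>\<nu>\<close>, and moves the down step of the chord to the position of its up step. Processing
  the down steps of \<open>\<mu>\<close> from left to right and moving each one as often as its label says
  never cuts through an earlier tile, because inside a tile all steps are matched among themselves.

  For \<open>\<zeta>\<close>, the label of a down step says how deep in the stack of open pairs its partner is.\<close>

subsection \<open>Paths, skew shapes and tiles on antidiagonals\<close>

text \<open>The ordinate at which \<open>p\<close> meets the antidiagonal x + y = t. It is continued
  by constants to all integers, so paths can be compared on every antidiagonal without range
  conditions.\<close>

definition U :: "bool list \<Rightarrow> int \<Rightarrow> int" where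
  "U p t = int (ups (take (nat t) p))"

lemma U_le_zero [simp]: "t \<le> 0 \<Longrightarrow> U p t = 0"
  by (simp add: U_def ups_def)

lemma U_ge_length: "int (length p) \<le> t \<Longrightarrow> U p t = int (ups p)"
  by (simp add: U_def)

lemma U_Suc: "U p (t + 1) = U p t + (if 0 \<le> t \<and> t < int (length p) \<and> p ! nat t then 1 else 0)"
proof (cases "0 \<le> t \<and> t < int (length p)")
  case True
  then have "nat (t + 1) = Suc (nat t)" "nat t < length p" by auto
  then show ?thesis using True
    by (simp add: U_def take_Suc_conv_app_nth ups_def)
next
  case False
  then show ?thesis
    by (cases "t < 0") (auto simp: U_ge_length)
qed

lemma U_int_Suc:
  "j < length p \<Longrightarrow> U p (int j + 1) = U p (int j) + (if p ! j then 1 else 0)"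
  by (subst U_Suc) simp

lemma U_mono_diff:
  assumes "s \<le> t" shows "U p s \<le> U p t \<and> U p t - U p s \<le> t - s"
  using assms
proof (induction t rule: int_ge_induct)
  case (step i)
  then show ?case using U_Suc[of p i] by (auto split: if_splits)
qed simp

lemmas U_mono = U_mono_diff[THEN conjunct1]
lemmas U_diff = U_mono_diff[THEN conjunct2]

lemma U_le: "0 \<le> t \<Longrightarrow> U p t \<le> t"
  using U_diff[of 0 t p] by simp

lemma ups_downs: "ups xs + downs xs = length xs"
  unfolding ups_def downs_def by (induction xs) auto

lemma downs_take: "j \<le> length p \<Longrightarrow> int (downs (take j p)) = int j - U p (int j)"
  using ups_downs[of "take j p"] by (simp add: U_def)

text \<open>The first t steps contain t - \<open>U p t\<close> down steps, so
  \<open>2 * U p t - t\<close> is the height above the diagonal. All later height arguments use this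
  quantity.\<close>

lemma dyck_word_iff:
  "dyck_word p \<longleftrightarrow> 2 * int (ups p) = int (length p) \<and>
     (\<forall>t. 0 \<le> t \<and> t \<le> int (length p) \<longrightarrow> t \<le> 2 * U p t)"
proof -
  have "downs (take k p) \<le> ups (take k p) \<longleftrightarrow> int k \<le> 2 * U p (int k)" if "k \<le> length p" for k
    using downs_take[OF that] by (auto simp: U_def)
  then have "(\<forall>k\<le>length p. downs (take k p) \<le> ups (take k p)) \<longleftrightarrow>
    (\<forall>k\<le>length p. int k \<le> 2 * U p (int k))"
    by blast
  also have "\<dots> \<longleftrightarrow> (\<forall>t. 0 \<le> t \<and> t \<le> int (length p) \<longrightarrow> t \<le> 2 * U p t)"
    by (metis nat_0_le nat_le_iff of_nat_0_le_iff of_nat_le_iff)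
  finally show ?thesis using ups_downs[of p] unfolding dyck_word_def by auto
qed

lemma dyck_pathsD:
  assumes "p \<in> dyck_paths n"
  shows "length p = 2 * n" "ups p = n" "\<And>t. 0 \<le> t \<Longrightarrow> t \<le> 2 * int n \<Longrightarrow> t \<le> 2 * U p t"
    "\<And>t. t \<ge> 2 * int n \<Longrightarrow> U p t = int n"
  using assms U_ge_length[of p] by (auto simp: dyck_paths_def dyck_word_iff)

text \<open>Cells and horizontal edges in terms of \<open>y\<close> and the antidiagonal \<open>t\<close>: \<open>cl t y\<close> is the cell
  whose northwest and southeast corners lie on \<open>x + y = t\<close>, and \<open>ed t y\<close> is the edge starting there.
  A path meets this antidiagonal at ordinate \<open>U p t\<close>, so skew shapes become conditions on \<open>y\<close> for
  each \<open>t\<close> separately, and \<open>shift\<close> lowers \<open>y\<close> by one.\<close>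
definition cl :: "int \<Rightarrow> int \<Rightarrow> cell" where "cl t y = (t - 1 - y, y)"
definition ed :: "int \<Rightarrow> int \<Rightarrow> int \<times> int" where "ed t y = (t - y, y)"

lemma cl_eq [simp]: "cl t y = cl t' y' \<longleftrightarrow> t = t' \<and> y = y'"
  by (auto simp: cl_def)

lemma ed_eq [simp]: "ed t y = ed t' y' \<longleftrightarrow> t = t' \<and> y = y'"
  by (auto simp: ed_def)

lemma cell_cl: "(x, y) = cl (x + y + 1) y"
  by (simp add: cl_def)

lemma shift_cl [simp]: "shift (cl t y) = cl t (y - 1)"
  by (simp add: shift_def cl_def)

lemma step_start_ed: "j \<le> length p \<Longrightarrow> step_start p j = ed (int j) (U p (int j))"
  by (simp add: step_start_def ed_def downs_take) (simp add: U_def)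

text \<open>Gives meaning to the \<open>THE\<close> in \<open>col_height\<close>. The number of down
  steps before step j is j - \<open>U p j\<close>; the step just before this count first exceeds x
  is the down step of column x, and no two down steps have the same count.\<close>

lemma col_height_ex1:
  assumes p: "p \<in> dyck_paths n" and x: "0 \<le> x" "x < int n"
  shows "\<exists>!y. \<exists>j\<in>down_steps p. step_start p j = (x, y)"
proof -
  note D = dyck_pathsD[OF p]
  let ?Q = "\<lambda>k::nat. x < int k - U p (int k)"
  define m where "m = (LEAST k. ?Q k)"
  have Q: "?Q (2 * n)" using D(4)[of "2 * int n"] x by simp
  have Qm: "?Q m" unfolding m_def by (rule LeastI[of ?Q, OF Q])
  have "m \<le> 2 * n" unfolding m_def by (rule Least_le[of ?Q, OF Q])
  moreover have "m \<noteq> 0" using Qm x by (intro notI) simp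
  ultimately obtain j where j: "m = Suc j" "j < length p" using D(1) by (cases m) auto
  have "\<not> ?Q j" using not_less_Least[of j ?Q] j m_def by simp
  with Qm j U_int_Suc[of j p] have "\<not> p ! j" "int j - U p (int j) = x"
    by (auto split: if_splits simp: add.commute)
  then have ex: "\<exists>j\<in>down_steps p. step_start p j = (x, U p (int j))"
    using j by (intro bexI[of _ j]) (auto simp: down_steps_def step_start_ed ed_def)
  have "i \<ge> k" if "i \<in> down_steps p" "k \<in> down_steps p"
     "int i - U p (int i) = int k - U p (int k)" for i k
  proof (rule ccontr)
    assume "\<not> i \<ge> k"
    then show False using that U_diff[of "int i + 1" "int k" p] U_int_Suc[of i p]
      by (auto simp: down_steps_def)
  qed
  then have "i = k" if "i \<in> down_steps p" "k \<in> down_steps p"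
     "int i - U p (int i) = int k - U p (int k)" for i k using that by (metis le_antisym)
  then show ?thesis using ex
    by (auto simp: down_steps_def step_start_ed ed_def)
qed

text \<open>Passage from columns to antidiagonals: \<open>U\<close> grows by at most one per step,
  so walking from the down step of column x to the antidiagonal of the cell, in either direction,
  the path cannot cross to the other side of the cell.\<close>

lemma less_col_height_iff:
  assumes p: "p \<in> dyck_paths n" and x: "0 \<le> x" "x < int n"
  shows "y < col_height p x \<longleftrightarrow> y < U p (x + y + 1)"
proof -
  obtain j where j: "j \<in> down_steps p" "step_start p j = (x, col_height p x)"
    using theI'[OF col_height_ex1[OF assms]] unfolding col_height_def by auto
  then have *: "x = int j - U p (int j)" "col_height p x = U p (int j)" "U p (int j + 1) = U p (int j)"
    by (auto simp: down_steps_def step_start_ed ed_def U_int_Suc)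
  show ?thesis
    using * U_diff[of "x + y + 1" "int j" p] U_diff[of "int j + 1" "x + y + 1" p]
    by (cases "y < col_height p x") auto
qed

text \<open>Both paths agree for t \<le> 0 and for t \<ge> 2n, so a cell between them lies on an
  inner antidiagonal. Either path may be the lower one; \<open>weakly_above_iff\<close> uses the
  lemma with the roles exchanged.\<close>

lemma between_bounds:
  assumes p: "p \<in> dyck_paths n" and q: "q \<in> dyck_paths n"
    and y: "U p (x + y + 1) \<le> y" "y < U q (x + y + 1)"
  shows "0 \<le> x" "x < int n"
proof -
  let ?t = "x + y + 1"
  have t: "0 < ?t" using y by (cases "?t \<le> 0") auto
  have t2: "?t < 2 * int n"
    using y dyck_pathsD(4)[OF p, of ?t] dyck_pathsD(4)[OF q, of ?t] by (cases "?t < 2 * int n") auto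
  show "0 \<le> x" using U_le[of ?t q] t y by simp
  show "x < int n" using U_diff[of ?t "2 * int n" p] t2 y dyck_pathsD(4)[OF p, of "2 * int n"] by simp
qed

lemma skew_cells_iff:
  assumes "\<nu> \<in> dyck_paths n" "\<mu> \<in> dyck_paths n"
  shows "cl t y \<in> skew_cells \<nu> \<mu> \<longleftrightarrow> U \<nu> t \<le> y \<and> y < U \<mu> t"
proof -
  have l: "int (length \<mu> div 2) = int n" using dyck_pathsD(1)[OF assms(2)] by simp
  show ?thesis
    using between_bounds[OF assms, of "t - 1 - y" y]
      less_col_height_iff[OF assms(1), of "t - 1 - y" y]
      less_col_height_iff[OF assms(2), of "t - 1 - y" y]
    unfolding skew_cells_def cl_def l by (auto simp flip: not_less)
qed

lemma weakly_above_iff: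
  assumes "\<nu> \<in> dyck_paths n" "\<mu> \<in> dyck_paths n"
  shows "weakly_above \<mu> \<nu> \<longleftrightarrow> (\<forall>t. U \<nu> t \<le> U \<mu> t)"
proof -
  have l: "int (length \<mu> div 2) = int n" "length \<nu> = length \<mu>"
    using dyck_pathsD(1)[OF assms(1)] dyck_pathsD(1)[OF assms(2)] by simp_all
  show ?thesis unfolding weakly_above_def l
  proof (safe)
    fix t assume *: "\<forall>x. 0 \<le> x \<and> x < int n \<longrightarrow> col_height \<nu> x \<le> col_height \<mu> x"
    show "U \<nu> t \<le> U \<mu> t"
    proof (rule ccontr)
      assume "\<not> U \<nu> t \<le> U \<mu> t"
      \<comment> \<open>The cell directly above \<mu> on this antidiagonal lies below \<nu>, which
        contradicts the comparison in its column.\<close>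
      moreover define y x where "y = U \<mu> t" and "x = t - 1 - y"
      ultimately have "U \<mu> (x + y + 1) \<le> y" "y < U \<nu> (x + y + 1)" by auto
      moreover note between_bounds[OF assms(2,1) this]
      ultimately show False
        using * less_col_height_iff[OF assms(1), of x y] less_col_height_iff[OF assms(2), of x y]
        by fastforce
    qed
  next
    fix x assume *: "\<forall>t. U \<nu> t \<le> U \<mu> t" and "0 \<le> x" "x < int n"
    then show "col_height \<nu> x \<le> col_height \<mu> x"
      using less_col_height_iff[OF assms(1), of x "col_height \<nu> x - 1"]
        less_col_height_iff[OF assms(2), of x "col_height \<nu> x - 1"]
      by (smt (verit, best))
  qed
qed

section \<open>Tiles as graphs over intervals of antidiagonals\<close>

text \<open>Up to a constant, \<open>2 * g t - t\<close> is the height of the cell center on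
  antidiagonal \<open>t\<close>, so the last two conditions are those of a translated Dyck
  path.\<close>

definition tile :: "cell set \<Rightarrow> int \<Rightarrow> int \<Rightarrow> (int \<Rightarrow> int) \<Rightarrow> bool" where
  "tile T a b g \<longleftrightarrow> a \<le> b \<and> T = (\<lambda>t. cl t (g t)) ` {a..b} \<and>
     (\<forall>t. a \<le> t \<and> t < b \<longrightarrow> g (t + 1) = g t \<or> g (t + 1) = g t + 1) \<and>
     (\<forall>t. a \<le> t \<and> t \<le> b \<longrightarrow> 2 * g a - a \<le> 2 * g t - t) \<and> 2 * g b - b = 2 * g a - a"

lemma path_cells_eq:
  "set (path_cells (cl a y) w) = (\<lambda>t. cl t (y + U w (t - a))) ` {a..a + int (length w)}"
proof (induction w arbitrary: a y)
  case Nil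
  show ?case by (auto simp: cl_def)
next
  case (Cons b w)
  have U: "U (b # w) (t - a) = (if b then 1 else 0) + U w (t - (a + 1))" if "a + 1 \<le> t" for t
  proof -
    have "nat (t - a) = Suc (nat (t - (a + 1)))" using that by auto
    then show ?thesis by (simp add: U_def ups_def)
  qed
  have "(if b then (a - 1 - y, y + 1) else (a - 1 - y + 1, y)) = cl (a + 1) (y + (if b then 1 else 0))"
    by (simp add: cl_def)
  then have "set (path_cells (cl a y) (b # w)) = insert (cl a y)
     ((\<lambda>t. cl t (y + (if b then 1 else 0) + U w (t - (a + 1)))) ` {a + 1..a + 1 + int (length w)})"
    using Cons.IH[of "a + 1" "y + (if b then 1 else 0)"] by (simp add: cl_def)
  also have "(\<lambda>t. cl t (y + (if b then 1 else 0) + U w (t - (a + 1)))) ` {a + 1..a + 1 + int (length w)}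
     = (\<lambda>t. cl t (y + U (b # w) (t - a))) ` {a + 1..a + 1 + int (length w)}"
    by (intro image_cong refl) (auto simp: U)
  also have "insert (cl a y) \<dots> = (\<lambda>t. cl t (y + U (b # w) (t - a))) ` insert a {a + 1..a + 1 + int (length w)}"
    by simp
  also have "insert a {a + 1..a + 1 + int (length w)} = {a..a + int (length (b # w))}" by auto
  finally show ?case .
qed

lemma tile_path_cells:
  assumes "dyck_word w"
  shows "tile (set (path_cells (cl a y) w)) a (a + int (length w)) (\<lambda>t. y + U w (t - a))"
proof -
  have "U w (t + 1 - a) = U w (t - a) \<or> U w (t + 1 - a) = U w (t - a) + 1" for t
    using U_Suc[of w "t - a"] by (auto simp: algebra_simps split: if_splits)
  moreover have "t - a \<le> 2 * U w (t - a)" if "a \<le> t" "t \<le> a + int (length w)" for t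
    using assms that unfolding dyck_word_iff by (elim conjE allE[of _ "t - a"]) linarith
  moreover have "2 * U w (int (length w)) = int (length w)"
    using assms U_ge_length[of w "int (length w)"] unfolding dyck_word_iff by simp
  ultimately show ?thesis
    unfolding tile_def path_cells_eq by (intro conjI allI impI) (auto simp: algebra_simps)
qed

lemma dyck_tile_tile: "dyck_tile T \<Longrightarrow> \<exists>a b g. tile T a b g"
  unfolding dyck_tile_def using tile_path_cells cell_cl by (metis prod.exhaust)

text \<open>By \<open>tile_unique\<close> the choice is forced, except for the values of
  \<open>gt T\<close> outside the interval from \<open>lo T\<close> to \<open>hi T\<close>.\<close>

definition lo :: "cell set \<Rightarrow> int" where "lo T = fst (SOME z. tile T (fst z) (fst (snd z)) (snd (snd z)))"
definition hi :: "cell set \<Rightarrow> int" where "hi T = fst (snd (SOME z. tile T (fst z) (fst (snd z)) (snd (snd z))))"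
definition gt :: "cell set \<Rightarrow> int \<Rightarrow> int" where "gt T = snd (snd (SOME z. tile T (fst z) (fst (snd z)) (snd (snd z))))"

lemma dyck_tile_params: "dyck_tile T \<Longrightarrow> tile T (lo T) (hi T) (gt T)"
  unfolding lo_def hi_def gt_def
  by (rule someI_ex[where P = "\<lambda>z. tile T (fst z) (fst (snd z)) (snd (snd z))"])
    (use dyck_tile_tile in force)

lemma tile_mem: "tile T a b g \<Longrightarrow> cl t y \<in> T \<longleftrightarrow> a \<le> t \<and> t \<le> b \<and> y = g t"
  by (auto simp: tile_def)

lemma tile_mono:
  assumes "tile T a b g" "a \<le> s" "s \<le> t" "t \<le> b"
  shows "g s \<le> g t \<and> g t - g s \<le> t - s"
  using assms(3,4)
proof (induction t rule: int_ge_induct)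
  case (step i)
  then have "g (i + 1) = g i \<or> g (i + 1) = g i + 1" using assms unfolding tile_def by auto
  then show ?case using step by auto
qed simp

lemma tile_unique:
  assumes "tile T a b g" "tile T a' b' g'"
  shows "a = a'" "b = b'" "\<And>t. a \<le> t \<Longrightarrow> t \<le> b \<Longrightarrow> g t = g' t"
proof -
  have *: "a \<le> t \<and> t \<le> b \<and> y = g t \<longleftrightarrow> a' \<le> t \<and> t \<le> b' \<and> y = g' t" for t y
    using tile_mem[OF assms(1), of t y] tile_mem[OF assms(2), of t y] by blast
  have "a \<le> b" "a' \<le> b'" using assms by (auto simp: tile_def)
  then show "a = a'" "b = b'" using *[of a "g a"] *[of a' "g' a'"] *[of b "g b"] *[of b' "g' b'"]
    by auto
  show "g t = g' t" if "a \<le> t" "t \<le> b" for t using *[of t "g t"] that by auto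
qed

text \<open>\<open>ne_cell\<close> takes the two maxima separately; both are attained at the last
  cell because neither coordinate decreases along a tile.\<close>

lemma tile_ne_cell:
  assumes "tile T a b g" shows "ne_cell T = cl b (g b)"
proof -
  have f: "finite T" "cl b (g b) \<in> T" using assms by (auto simp: tile_def)
  have "Max (fst ` T) = b - 1 - g b"
  proof (rule Max_eqI)
    show "b - 1 - g b \<in> fst ` T" using f by (force simp: cl_def)
    fix x assume "x \<in> fst ` T"
    then obtain t where t: "a \<le> t" "t \<le> b" "x = t - 1 - g t"
      using assms by (auto simp: tile_def cl_def)
    then show "x \<le> b - 1 - g b" using tile_mono[OF assms, of t b] by auto
  qed (use f in auto)
  moreover have "Max (snd ` T) = g b"
  proof (rule Max_eqI)
    show "g b \<in> snd ` T" using f by (force simp: cl_def)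
    fix x assume "x \<in> snd ` T"
    then obtain t where t: "a \<le> t" "t \<le> b" "x = g t"
      using assms by (auto simp: tile_def cl_def)
    then show "x \<le> g b" using tile_mono[OF assms, of t b] by auto
  qed (use f in auto)
  ultimately show ?thesis by (simp add: ne_cell_def cl_def)
qed

lemma tile_sw_cell:
  assumes "tile T a b g" shows "sw_cell T = cl a (g a)"
proof -
  have f: "finite T" "cl a (g a) \<in> T" using assms by (auto simp: tile_def)
  have "Min (fst ` T) = a - 1 - g a"
  proof (rule Min_eqI)
    show "a - 1 - g a \<in> fst ` T" using f by (force simp: cl_def)
    fix x assume "x \<in> fst ` T"
    then obtain t where t: "a \<le> t" "t \<le> b" "x = t - 1 - g t"
      using assms by (auto simp: tile_def cl_def)
    then show "x \<ge> a - 1 - g a" using tile_mono[OF assms, of a t] by auto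
  qed (use f in auto)
  moreover have "Min (snd ` T) = g a"
  proof (rule Min_eqI)
    show "g a \<in> snd ` T" using f by (force simp: cl_def)
    fix x assume "x \<in> snd ` T"
    then obtain t where t: "a \<le> t" "t \<le> b" "x = g t"
      using assms by (auto simp: tile_def cl_def)
    then show "x \<ge> g a" using tile_mono[OF assms, of a t] by auto
  qed (use f in auto)
  ultimately show ?thesis by (simp add: sw_cell_def cl_def)
qed

text \<open>A north edge starts at the northwest corner, on the antidiagonal of its cell, but a
  south edge starts one antidiagonal earlier. Hence the exit of \<open>S\<close> can be the entry of
  \<open>T\<close> only if \<open>lo S = hi T + 1\<close>.\<close>

lemma tile_entry: "tile T a b g \<Longrightarrow> entry T = ed b (g b + 1)"
  by (simp add: entry_def tile_ne_cell) (simp add: cl_def ed_def)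

lemma tile_exit: "tile T a b g \<Longrightarrow> exit T = ed (a - 1) (g a)"
  by (simp add: exit_def tile_sw_cell) (simp add: cl_def ed_def)

subsection \<open>Chains of tiles\<close>

locale dyck_tiling =
  fixes n :: nat and \<mu> \<nu> :: "bool list" and P :: "cell set set"
  assumes mu: "\<mu> \<in> dyck_paths n" and nu: "\<nu> \<in> dyck_paths n" and P: "P \<in> dyck_tilings \<nu> \<mu>"
begin

lemma U_nu_le: "U \<nu> t \<le> U \<mu> t"
  using P weakly_above_iff[OF nu mu] unfolding dyck_tilings_def by (auto split: if_splits)

lemma P_unfold:
  "\<Union>P = skew_cells \<nu> \<mu>" "T \<in> P \<Longrightarrow> dyck_tile T"
  "T \<in> P \<Longrightarrow> S \<in> P \<Longrightarrow> T \<noteq> S \<Longrightarrow> T \<inter> S = {}" "cover_inclusive P"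
  using P unfolding dyck_tilings_def by (auto split: if_splits)

lemma tileP: "T \<in> P \<Longrightarrow> tile T (lo T) (hi T) (gt T)"
  by (simp add: P_unfold dyck_tile_params)

lemma lo_le_hi: "T \<in> P \<Longrightarrow> lo T \<le> hi T"
  and gt_Suc: "T \<in> P \<Longrightarrow> lo T \<le> t \<Longrightarrow> t < hi T \<Longrightarrow> gt T (t + 1) = gt T t \<or> gt T (t + 1) = gt T t + 1"
  and gt_ge: "T \<in> P \<Longrightarrow> lo T \<le> t \<Longrightarrow> t \<le> hi T \<Longrightarrow> 2 * gt T (lo T) - lo T \<le> 2 * gt T t - t"
  and gt_hi: "T \<in> P \<Longrightarrow> 2 * gt T (hi T) - hi T = 2 * gt T (lo T) - lo T"
  using tileP[of T] unfolding tile_def by blast+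

lemma mem: "T \<in> P \<Longrightarrow> cl t y \<in> T \<longleftrightarrow> lo T \<le> t \<and> t \<le> hi T \<and> y = gt T t"
  using tile_mem tileP by blast

lemma covered: "U \<nu> t \<le> y \<and> y < U \<mu> t \<longleftrightarrow> (\<exists>T\<in>P. lo T \<le> t \<and> t \<le> hi T \<and> y = gt T t)"
  using skew_cells_iff[OF nu mu, of t y] P_unfold(1) mem by (metis UnionE UnionI)

lemma gt_bounds:
  assumes "T \<in> P" "lo T \<le> t" "t \<le> hi T"
  shows "U \<nu> t \<le> gt T t" "gt T t < U \<mu> t"
  using covered[of t "gt T t"] assms by auto

lemma same_tile:
  assumes "T \<in> P" "S \<in> P" "lo T \<le> t" "t \<le> hi T" "lo S \<le> t" "t \<le> hi S" "gt T t = gt S t"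
  shows "T = S"
proof (rule ccontr)
  assume "T \<noteq> S"
  moreover have "cl t (gt T t) \<in> T" "cl t (gt T t) \<in> S" using assms by (simp_all add: mem)
  ultimately show False using P_unfold(3)[OF assms(1,2)] by blast
qed

text \<open>\<open>S\<close> contains one translated cell of \<open>T\<close>, hence by
  cover-inclusion the whole translate.\<close>

lemma cover1:
  assumes "S \<in> P" "T \<in> P" "lo T \<le> t" "t \<le> hi T" "lo S \<le> t" "t \<le> hi S" "gt S t = gt T t - 1"
  shows "lo S \<le> lo T" "hi T \<le> hi S" "\<And>s. lo T \<le> s \<Longrightarrow> s \<le> hi T \<Longrightarrow> gt S s = gt T s - 1"
proof -
  have "cl t (gt T t) \<in> T" "shift (cl t (gt T t)) \<in> S" using assms by (auto simp: mem)
  then have sub: "shift ` T \<subseteq> S" using P_unfold(4) assms(1,2) unfolding cover_inclusive_def by blast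
  have *: "lo S \<le> s \<and> s \<le> hi S \<and> gt T s - 1 = gt S s" if "lo T \<le> s" "s \<le> hi T" for s
  proof -
    have "cl s (gt T s) \<in> T" using that assms by (auto simp: mem)
    then have "shift (cl s (gt T s)) \<in> S" using sub by blast
    then show ?thesis by (simp add: mem assms(1))
  qed
  show "lo S \<le> lo T" "hi T \<le> hi S" "\<And>s. lo T \<le> s \<Longrightarrow> s \<le> hi T \<Longrightarrow> gt S s = gt T s - 1"
    using *[of "lo T"] *[of "hi T"] * lo_le_hi[OF assms(2)] by force+
qed

text \<open>Iterated cover-inclusion: the \<open>m\<close>-fold translate of \<open>T\<close> under
  \<open>shift\<close> is part of \<open>S\<close>.\<close>

definition above :: "int \<Rightarrow> cell set \<Rightarrow> cell set \<Rightarrow> bool" where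
  "above m T S \<longleftrightarrow> 0 < m \<and> lo S \<le> lo T \<and> hi T \<le> hi S \<and>
     (\<forall>s. lo T \<le> s \<and> s \<le> hi T \<longrightarrow> gt S s = gt T s - m)"

text \<open>One common antidiagonal suffices. The cell just below \<open>T\<close> there is still in
  the skew shape; the induction passes from \<open>T\<close> to the tile \<open>R\<close> covering
  it.\<close>

lemma aboveI:
  assumes "S \<in> P" "T \<in> P" "lo T \<le> t" "t \<le> hi T" "lo S \<le> t" "t \<le> hi S" "gt S t = gt T t - m" "0 < m"
  shows "above m T S"
  using assms(8,2-4,7)
proof (induction m arbitrary: T rule: int_gr_induct)
  case base
  then show ?case using cover1[of S T t] assms by (auto simp: above_def)
next
  case (step i)
  have "U \<nu> t \<le> gt T t - 1 \<and> gt T t - 1 < U \<mu> t"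
    using gt_bounds[of S t] gt_bounds[of T t] assms step by auto
  then obtain R where R: "R \<in> P" "lo R \<le> t" "t \<le> hi R" "gt R t = gt T t - 1"
    using covered by metis
  then have "above i R S" using step by auto
  moreover note cover1[OF R(1) step(3-5) R(2-4)]
  ultimately show ?case using step.prems step.hyps lo_le_hi[OF step.prems(1)] unfolding above_def
    by (smt (verit))
qed

lemma entryP: "T \<in> P \<Longrightarrow> entry T = ed (hi T) (gt T (hi T) + 1)"
  and exitP: "T \<in> P \<Longrightarrow> exit T = ed (lo T - 1) (gt T (lo T))"
  using tile_entry tile_exit tileP by blast+

lemma entry_inj: "T \<in> P \<Longrightarrow> S \<in> P \<Longrightarrow> entry T = entry S \<Longrightarrow> T = S"
  using same_tile[of T S "hi T"] lo_le_hi[of T] lo_le_hi[of S] by (auto simp: entryP)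

lemma exit_inj: "T \<in> P \<Longrightarrow> S \<in> P \<Longrightarrow> exit T = exit S \<Longrightarrow> T = S"
  using same_tile[of T S "lo T"] lo_le_hi[of T] lo_le_hi[of S] by (auto simp: exitP)

lemma U_mu_step: "U \<mu> t \<le> U \<mu> (t + 1)" "U \<mu> (t + 1) \<le> U \<mu> t + 1"
  using U_mono[of t "t + 1" \<mu>] U_diff[of t "t + 1" \<mu>] by auto

lemma U_nu_step: "U \<nu> t \<le> U \<nu> (t + 1)" "U \<nu> (t + 1) \<le> U \<nu> t + 1"
  using U_mono[of t "t + 1" \<nu>] U_diff[of t "t + 1" \<nu>] by auto

lemma range_mu:
  assumes "T \<in> P" "lo T \<le> t" "t \<le> hi T"
  shows "0 < t" "t < 2 * int n"
proof -
  have "U \<nu> t < U \<mu> t" using gt_bounds[OF assms] by simp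
  moreover have "U \<nu> t = U \<mu> t" if "t \<le> 0" using that by simp
  moreover have "U \<nu> t = U \<mu> t" if "2 * int n \<le> t"
    using that dyck_pathsD(4)[OF mu, of t] dyck_pathsD(4)[OF nu, of t] by simp
  ultimately have "\<not> t \<le> 0" "\<not> 2 * int n \<le> t" by auto
  then show "0 < t" "t < 2 * int n" by simp_all
qed

text \<open>Consider the cell north of the northeast cell of \<open>T\<close>. If it is in the skew
  shape, its tile starts there; if not, the entry of \<open>T\<close> lies on \<mu>.\<close>

lemma parent:
  assumes "T \<in> P"
  shows "(\<exists>j\<in>down_steps \<mu>. int j = hi T \<and> entry T = step_start \<mu> j) \<or> (\<exists>S\<in>P. entry T = exit S)"
proof -
  define b y where "b = hi T" and "y = gt T b"
  have r: "0 < b" "b < 2 * int n" using range_mu[OF assms, of b] lo_le_hi[OF assms] b_def by auto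
  have bd: "U \<nu> b \<le> y" "y < U \<mu> b" using gt_bounds[OF assms, of b] lo_le_hi[OF assms] b_def y_def by auto
  show ?thesis
  proof (cases "y + 1 < U \<mu> (b + 1)")
    case True
    have "U \<nu> (b + 1) \<le> y + 1" using bd U_nu_step[of b] by auto
    with True obtain S where S: "S \<in> P" "lo S \<le> b + 1" "b + 1 \<le> hi S" "gt S (b + 1) = y + 1"
      using covered[of "b + 1" "y + 1"] by auto
    \<comment> \<open>Otherwise \<open>S\<close> also has a cell on antidiagonal \<open>b\<close>.
      Either it is the last cell of \<open>T\<close>, or it lies directly above that cell, and then
      cover-inclusion makes \<open>S\<close> end no later than \<open>T\<close>.\<close>
    have "lo S = b + 1"
    proof (rule ccontr)
      assume "lo S \<noteq> b + 1"
      then have l: "lo S \<le> b" using S by simp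
      then consider "gt S b = y + 1" | "gt S b = y" using gt_Suc[OF S(1) l] S by fastforce
      then show False
      proof cases
        case 1
        then show False using cover1(2)[OF assms S(1), of b] S l lo_le_hi[OF assms] b_def y_def by auto
      next
        case 2
        then have "S = T" using same_tile[OF S(1) assms, of b] S l lo_le_hi[OF assms] b_def y_def by auto
        then show False using S b_def by auto
      qed
    qed
    then have "entry T = exit S" using S by (simp add: entryP[OF assms] exitP b_def[symmetric] y_def[symmetric])
    then show ?thesis using S by blast
  next
    case False
    then have eq: "U \<mu> b = y + 1" "U \<mu> (b + 1) = y + 1" using U_mu_step[of b] bd by auto
    have "b < int (length \<mu>)" using r dyck_pathsD(1)[OF mu] by auto
    then have "nat b < length \<mu>" "nat b \<in> down_steps \<mu>"
      using U_Suc[of \<mu> b] eq r by (auto simp: down_steps_def)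
    moreover have "entry T = step_start \<mu> (nat b)"
      using \<open>nat b < length \<mu>\<close> eq r by (simp add: entryP[OF assms] step_start_ed b_def[symmetric] y_def[symmetric])
    ultimately show ?thesis using r b_def by (intro disjI1 bexI[of _ "nat b"]) auto
  qed
qed

text \<open>The cell north of an exit belongs to a tile, the cell north of a step of \<mu> is
  outside the shape.\<close>

lemma mu_not_exit:
  assumes "j \<in> down_steps \<mu>" "S \<in> P" shows "exit S \<noteq> step_start \<mu> j"
proof
  assume "exit S = step_start \<mu> j"
  then have "lo S = int j + 1" "gt S (lo S) = U \<mu> (int j)"
    using assms by (auto simp: exitP step_start_ed down_steps_def)
  moreover have "U \<mu> (int j + 1) = U \<mu> (int j)" using assms by (auto simp: U_int_Suc down_steps_def)
  ultimately show False using gt_bounds[OF assms(2), of "lo S"] lo_le_hi[OF assms(2)] by auto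
qed

lemma step_start_inj:
  "j \<in> down_steps p \<Longrightarrow> i \<in> down_steps p \<Longrightarrow> step_start p j = step_start p i \<Longrightarrow> j = i"
  by (simp add: step_start_ed down_steps_def)

end

section \<open>Labels as lengths of chains\<close>

text \<open>The tile passed at jump \<open>k\<close> when travelling from \<open>e\<close>, as a set
  that is empty or a singleton (\<open>chain_unique\<close>). This keeps it independent of
  \<open>next_edge\<close> at edges that are not entries, where \<open>THE\<close> is
  unspecified.\<close>

primrec chain :: "cell set set \<Rightarrow> int \<times> int \<Rightarrow> nat \<Rightarrow> cell set set" where
  "chain P e 0 = {T \<in> P. entry T = e}"
| "chain P e (Suc k) = {T \<in> P. \<exists>S \<in> chain P e k. entry T = exit S}"

text \<open>The height above the diagonal of the start of an edge; on down steps of a Dyck path it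
  agrees with \<open>ht\<close> (\<open>ht_eq\<close>).\<close>

definition hgt :: "int \<times> int \<Rightarrow> int" where "hgt e = snd e - fst e"

lemma hgt_ed [simp]: "hgt (ed t y) = 2 * y - t"
  by (simp add: hgt_def ed_def)

context dyck_tiling
begin

lemma next_entry: "T \<in> P \<Longrightarrow> next_edge P (entry T) = exit T"
  unfolding next_edge_def by (rule arg_cong[where f = exit], rule the_equality) (auto dest: entry_inj)

lemma chain_sub: "T \<in> chain P e k \<Longrightarrow> T \<in> P"
  by (cases k) auto

lemma chain_next: "T \<in> chain P e k \<Longrightarrow> (next_edge P ^^ k) e = entry T \<and> (next_edge P ^^ Suc k) e = exit T"
proof (induction k arbitrary: T)
  case (Suc k)
  then obtain S where S: "S \<in> chain P e k" "entry T = exit S" "T \<in> P" by auto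
  then have "(next_edge P ^^ Suc k) e = entry T" using Suc.IH[OF S(1)] S(2) by (metis)
  then show ?case using next_entry[OF S(3)] by simp
qed (auto simp: next_entry)

lemma chain_unique: "T \<in> chain P e k \<Longrightarrow> S \<in> chain P e k \<Longrightarrow> T = S"
  using chain_next[of T e k] chain_next[of S e k] entry_inj chain_sub by metis

text \<open>The first and last cells of a tile have the same height, so its exit is exactly one
  lower than its entry.\<close>

lemma chain_hgt: "T \<in> chain P e k \<Longrightarrow> hgt (exit T) = hgt e - int k - 1"
proof (induction k arbitrary: T)
  case 0
  then show ?case using gt_hi[of T] entryP[of T] by (auto simp: exitP)
next
  case (Suc k)
  then obtain S where S: "S \<in> chain P e k" "entry T = exit S" "T \<in> P" by auto
  then have "hgt (exit S) = 2 * gt T (hi T) + 2 - hi T" using entryP[of T] by (metis hgt_ed distrib_left mult_2 numeral_Bit0 one_add_one mult.right_neutral)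
  then show ?case using Suc.IH[OF S(1)] gt_hi[OF S(3)] by (simp add: exitP S)
qed

text \<open>Tiles lie above \<nu>, which stays above the diagonal. With \<open>chain_hgt\<close>
  this bounds the length of every chain.\<close>

lemma exit_hgt_pos: "T \<in> P \<Longrightarrow> 1 \<le> hgt (exit T)"
proof -
  assume T: "T \<in> P"
  have "lo T \<le> 2 * U \<nu> (lo T)" "U \<nu> (lo T) \<le> gt T (lo T)"
    using range_mu[OF T, of "lo T"] gt_bounds[OF T, of "lo T"] lo_le_hi[OF T] dyck_pathsD(3)[OF nu, of "lo T"]
    by auto
  then show ?thesis by (simp add: exitP T)
qed

lemma chain_nonempty_mono: "chain P e k \<noteq> {} \<Longrightarrow> i \<le> k \<Longrightarrow> chain P e i \<noteq> {}"
  by (induction k) (auto simp: le_Suc_eq)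

text \<open>An iterate of \<open>next_edge\<close> is meaningful only as long as all earlier edges
  are entries, hence the condition for every index up to \<open>k\<close>.\<close>

lemma chain_iff: "(\<forall>i\<le>k. \<exists>T\<in>P. entry T = (next_edge P ^^ i) e) \<longleftrightarrow> chain P e k \<noteq> {}"
proof
  show "chain P e k \<noteq> {}" if "\<forall>i\<le>k. \<exists>T\<in>P. entry T = (next_edge P ^^ i) e"
    using that
  proof (induction k)
    case (Suc k)
    then obtain S where S: "S \<in> chain P e k" by force
    from Suc.prems obtain T where "T \<in> P" "entry T = (next_edge P ^^ Suc k) e" by blast
    then have "T \<in> chain P e (Suc k)" using S chain_next[OF S] by auto
    then show ?case by blast
  qed auto
  show "\<forall>i\<le>k. \<exists>T\<in>P. entry T = (next_edge P ^^ i) e" if "chain P e k \<noteq> {}"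
    using chain_nonempty_mono[OF that] chain_next chain_sub by (metis ex_in_conv)
qed

lemma chain_bound: "chain P e k \<noteq> {} \<Longrightarrow> int k + 2 \<le> hgt e"
proof -
  assume "chain P e k \<noteq> {}"
  then obtain T where T: "T \<in> chain P e k" by blast
  show ?thesis using chain_hgt[OF T] exit_hgt_pos[OF chain_sub[OF T]] by simp
qed

lemma psi_label_iff: "k < psi_label P e \<longleftrightarrow> chain P e k \<noteq> {}"
proof -
  let ?Q = "\<lambda>k. \<not> (\<exists>T\<in>P. entry T = (next_edge P ^^ k) e)"
  \<comment> \<open>Since heights drop along the chain, it has stopped by this index, so the
    \<open>LEAST\<close> in \<open>psi_label\<close> is attained.\<close>
  have "chain P e (nat (hgt e)) = {}" using chain_bound[of e "nat (hgt e)"] by linarith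
  then have "\<exists>k. ?Q k" using chain_iff[of "nat (hgt e)" e] by blast
  then have Q: "?Q (psi_label P e)" unfolding psi_label_def by (rule LeastI_ex)
  have L: "\<not> ?Q i" if "i < psi_label P e" for i
    using that unfolding psi_label_def by (rule not_less_Least)
  have "k < psi_label P e \<longleftrightarrow> (\<forall>i\<le>k. \<not> ?Q i)"
    using Q L by (metis le_less_trans linorder_not_less)
  then show ?thesis using chain_iff[of k e] by simp
qed

lemma psi_label_le_hgt: "0 < hgt e \<Longrightarrow> int (psi_label P e) < hgt e"
  using psi_label_iff[of "psi_label P e - 1" e] chain_bound[of e "psi_label P e - 1"]
  by (cases "psi_label P e") auto

text \<open>Passing from a tile to the one whose exit is its entry increases \<open>hi\<close>,
  which stays below 2n; so this ends, and by \<open>parent\<close> it ends at a down step of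
  \<mu>.\<close>

lemma chain_exists:
  assumes "T \<in> P"
  shows "\<exists>j\<in>down_steps \<mu>. \<exists>k. T \<in> chain P (step_start \<mu> j) k"
  using assms
proof (induction "nat (2 * int n - hi T)" arbitrary: T rule: less_induct)
  case less
  from parent[OF less.prems] show ?case
  proof (elim disjE bexE)
    fix S assume S: "S \<in> P" "entry T = exit S"
    then have "hi T < hi S" using lo_le_hi[of S] less.prems by (auto simp: entryP exitP)
    then have "\<exists>j\<in>down_steps \<mu>. \<exists>k. S \<in> chain P (step_start \<mu> j) k"
      using less.hyps[of S] S range_mu[OF S(1), of "hi S"] lo_le_hi[OF S(1)] by auto
    then obtain j k where "j\<in>down_steps \<mu>" "S \<in> chain P (step_start \<mu> j) k" by blast
    then show ?thesis using S less.prems by (intro bexI[of _ j] exI[of _ "Suc k"]) auto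
  next
    fix j assume "j \<in> down_steps \<mu>" "int j = hi T \<and> entry T = step_start \<mu> j"
    then show ?thesis using less.prems by (intro bexI[of _ j] exI[of _ 0]) auto
  qed
qed

text \<open>Chains can be traced backwards: an exit determines its tile, and a step of \<mu> is
  never an exit. The final edges are included, because the surjectivity proof needs the ends of
  different chains to differ.\<close>

lemma edge_unique:
  assumes "i \<in> down_steps \<mu>" "j \<in> down_steps \<mu>"
    and "k \<le> psi_label P (step_start \<mu> i)" "l \<le> psi_label P (step_start \<mu> j)"
    and "(next_edge P ^^ k) (step_start \<mu> i) = (next_edge P ^^ l) (step_start \<mu> j)"
  shows "i = j \<and> k = l"
  using assms(3-)
proof (induction k arbitrary: l)
  case 0
  note prems = 0
  show ?case
  proof (cases l)
    case 0
    then show ?thesis using prems assms(1,2) step_start_inj by simp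
  next
    case (Suc l')
    then obtain S where S: "S \<in> chain P (step_start \<mu> j) l'" using prems(2) psi_label_iff[of l' "step_start \<mu> j"] by auto
    then show ?thesis using chain_next[OF S] prems Suc mu_not_exit[OF assms(1) chain_sub[OF S]] by auto
  qed
next
  case (Suc k)
  then obtain S where S: "S \<in> chain P (step_start \<mu> i) k" using psi_label_iff[of k "step_start \<mu> i"] by auto
  show ?case
  proof (cases l)
    case 0
    then show ?thesis using Suc chain_next[OF S] mu_not_exit[OF assms(2) chain_sub[OF S]] by auto
  next
    case (Suc l')
    then obtain R where R: "R \<in> chain P (step_start \<mu> j) l'" using Suc.prems psi_label_iff[of l' "step_start \<mu> j"] by auto
    then have "R = S" using chain_next[OF S] chain_next[OF R] Suc Suc.prems exit_inj chain_sub S by metis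
    then have "(next_edge P ^^ k) (step_start \<mu> i) = (next_edge P ^^ l') (step_start \<mu> j)"
      using chain_next[OF S] chain_next[OF R] by metis
    then show ?thesis using Suc.IH[of l'] Suc.prems Suc by auto
  qed
qed

text \<open>A tile corresponds to the starting step of its chain together with its position there,
  and the label is the length of the chain.\<close>

lemma card_P: "card P = (\<Sum>j\<in>down_steps \<mu>. psi_label P (step_start \<mu> j))"
proof -
  let ?I = "SIGMA j:down_steps \<mu>. {..<psi_label P (step_start \<mu> j)}"
  let ?f = "\<lambda>(j, k). THE T. T \<in> chain P (step_start \<mu> j) k"
  have f: "?f (j, k) \<in> chain P (step_start \<mu> j) k" if jk: "(j, k) \<in> ?I" for j k
  proof -
    obtain T where "T \<in> chain P (step_start \<mu> j) k"
      using jk psi_label_iff[of k "step_start \<mu> j"] by auto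
    then have "\<exists>!T. T \<in> chain P (step_start \<mu> j) k" using chain_unique by blast
    then show ?thesis using theI'[of "\<lambda>T. T \<in> chain P (step_start \<mu> j) k"] by simp
  qed
  have "bij_betw ?f ?I P"
  proof (rule bij_betwI')
    fix x y assume x: "x \<in> ?I" and y: "y \<in> ?I"
    obtain j k i l where *: "x = (j, k)" "y = (i, l)" by fastforce
    show "?f x = ?f y \<longleftrightarrow> x = y"
    proof
      assume eq: "?f x = ?f y"
      then have "(next_edge P ^^ k) (step_start \<mu> j) = (next_edge P ^^ l) (step_start \<mu> i)"
        using f[of j k] f[of i l] x y chain_next unfolding * by (metis case_prod_conv)
      then show "x = y" using edge_unique[of j i k l] x y unfolding * by auto
    qed simp
  next
    fix x assume "x \<in> ?I"
    then show "?f x \<in> P" using f chain_sub by (cases x) blast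
  next
    fix T assume "T \<in> P"
    then obtain j k where "j \<in> down_steps \<mu>" "T \<in> chain P (step_start \<mu> j) k" using chain_exists by blast
    then show "\<exists>x\<in>?I. T = ?f x"
      using f[of j k] psi_label_iff[of k] chain_unique
      by (intro bexI[of _ "(j, k)"]) blast+
  qed
  then have "card P = card ?I" by (simp add: bij_betw_same_card)
  then show ?thesis by (simp add: down_steps_def)
qed

end

subsection \<open>Injectivity\<close>

definition root :: "bool list \<Rightarrow> cell set set \<Rightarrow> cell set \<Rightarrow> nat \<Rightarrow> bool" where
  "root \<mu> P T j \<longleftrightarrow> j \<in> down_steps \<mu> \<and> (\<exists>k. T \<in> chain P (step_start \<mu> j) k)"

context dyck_tiling
begin

lemma root_exists: "T \<in> P \<Longrightarrow> \<exists>j. root \<mu> P T j"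
  unfolding root_def using chain_exists by blast

lemma exit_entry_iff:
  "S \<in> P \<Longrightarrow> T \<in> P \<Longrightarrow> entry T = exit S \<longleftrightarrow> lo S = hi T + 1 \<and> gt S (lo S) = gt T (hi T) + 1"
  by (auto simp: entryP exitP)

lemma root_cases:
  assumes "root \<mu> P T j"
  obtains (top) "int j = hi T" "gt T (hi T) + 1 = U \<mu> (hi T)"
  | (parent) S where "S \<in> P" "root \<mu> P S j" "lo S = hi T + 1" "gt S (lo S) = gt T (hi T) + 1"
proof -
  from assms obtain k where j: "j \<in> down_steps \<mu>" and k: "T \<in> chain P (step_start \<mu> j) k"
    by (auto simp: root_def)
  have T: "T \<in> P" using chain_sub[OF k] .
  show thesis
  proof (cases k)
    case 0
    then have "entry T = step_start \<mu> j" using k by simp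
    then show thesis using j T by (intro top) (auto simp: entryP step_start_ed down_steps_def)
  next
    case (Suc k')
    then obtain S where S: "S \<in> chain P (step_start \<mu> j) k'" "entry T = exit S" using k by auto
    then have "root \<mu> P S j" unfolding root_def using j by blast
    moreover have "lo S = hi T + 1 \<and> gt S (lo S) = gt T (hi T) + 1"
      using S(2) T chain_sub[OF S(1)] exit_entry_iff[of S T] by blast
    ultimately show thesis using parent[of S] chain_sub[OF S(1)] by blast
  qed
qed

lemma root_in: "root \<mu> P T j \<Longrightarrow> T \<in> P"
  unfolding root_def using chain_sub by blast

lemma root_ge: "root \<mu> P T j \<Longrightarrow> hi T \<le> int j"
proof (induction "nat (2 * int n - hi T)" arbitrary: T rule: less_induct)
  case less
  from less.prems show ?case
  proof (cases rule: root_cases)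
    case (parent S)
    then show ?thesis
      using less.hyps[of S] lo_le_hi[of S] range_mu[of S "hi S"] by auto
  qed auto
qed

text \<open>A tile lying below another one reaches at least as far to the right, and so does its
  chain of predecessors: chains do not cross.\<close>
lemma above_root:
  assumes "above m T L" "root \<mu> P T i" "root \<mu> P L j"
  shows "i < j"
  using assms
proof (induction "nat (2 * int n - hi T)" arbitrary: T L m rule: less_induct)
  case less
  have TL: "T \<in> P" "L \<in> P" using less.prems root_in by auto
  have ab: "0 < m" "lo L \<le> lo T" "hi T \<le> hi L"
    "\<And>s. lo T \<le> s \<Longrightarrow> s \<le> hi T \<Longrightarrow> gt L s = gt T s - m"
    using less.prems(1) by (auto simp: above_def)
  note le = lo_le_hi[OF TL(1)] lo_le_hi[OF TL(2)]
  have g: "gt L (hi T) = gt T (hi T) - m" using ab(4)[of "hi T"] le by auto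
  from less.prems(2) show ?case
  proof (cases rule: root_cases)
    case top
    show ?thesis
    proof (cases "hi T = hi L")
      case True
      from less.prems(3) show ?thesis
      proof (cases rule: root_cases)
        case top
        then show ?thesis using g True \<open>0 < m\<close> \<open>gt T (hi T) + 1 = U \<mu> (hi T)\<close> by simp
      next
        case (parent S)
        then show ?thesis using root_ge[of S j] lo_le_hi[of S] True top by auto
      qed
    next
      case False
      then show ?thesis using root_ge[OF less.prems(3)] ab(3) top by simp
    qed
  next
    case (parent T1)
    have T1: "lo T1 \<le> hi T1" "hi T1 < 2 * int n"
      using lo_le_hi[of T1] range_mu[of T1 "hi T1"] parent by auto
    show ?thesis
    proof (cases "hi T = hi L")
      case True
      from less.prems(3) show ?thesis
      proof (cases rule: root_cases)
        case top
        then show ?thesis using g True \<open>0 < m\<close> gt_bounds(2)[OF TL(1), of "hi T"] le by simp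
      next
        case L1: (parent L1)
        \<comment> \<open>Both chains move on across the same antidiagonal, so their vertical
          distance is kept.\<close>
        have "above m T1 L1"
          by (rule aboveI[of L1 T1 "lo T1"]) (use L1 parent g True T1 ab lo_le_hi[of L1] in auto)
        then show ?thesis using less.hyps[of T1 m L1] parent T1 L1 by auto
      qed
    next
      case False
      then have L: "gt L (hi T + 1) = gt L (hi T) \<or> gt L (hi T + 1) = gt L (hi T) + 1"
        using gt_Suc[OF TL(2), of "hi T"] ab le by auto
      \<comment> \<open>This is \<open>m\<close> or \<open>m + 1\<close>, according to whether
        \<open>L\<close> goes up or right past the end of \<open>T\<close>; in both cases it is
        positive.\<close>
      define m' where "m' = gt T1 (lo T1) - gt L (lo T1)"
      have "above m' T1 L"
        by (rule aboveI[of L T1 "lo T1"]) (use L TL parent g False T1 ab le m'_def in auto)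
      then show ?thesis using less.hyps[of T1 m' L] less.prems parent T1 by auto
    qed
  qed
qed

text \<open>\<open>S\<close> covers the left neighbour of a cell of \<open>T\<close>. If
  \<open>T\<close> reaches that cell from below, then \<open>S\<close> lies directly above
  \<open>T\<close>. If \<open>T\<close> starts there, cover-inclusion forces \<open>S\<close> to
  end, and the next tile on the chain of \<open>S\<close>, if any, lies above \<open>T\<close>. Both
  cases reduce to \<open>above_root\<close>.\<close>

lemma left_root:
  assumes "S \<in> P" "T \<in> P" "S \<noteq> T" "root \<mu> P S i" "root \<mu> P T j"
    and T: "lo T \<le> t" "t \<le> hi T" and S: "lo S \<le> t - 1" "t - 1 \<le> hi S"
    and eq: "gt S (t - 1) = gt T t"
  shows "i < j"
proof (cases "lo T \<le> t - 1")
  case True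
  then have "gt T t = gt T (t - 1) \<or> gt T t = gt T (t - 1) + 1"
    using gt_Suc[OF assms(2), of "t - 1"] T by auto
  moreover have "gt T t \<noteq> gt T (t - 1)"
    using same_tile[OF assms(1,2), of "t - 1"] True T S eq assms(3) by auto
  ultimately have "above 1 S T"
    using aboveI[OF assms(2,1), of "t - 1" 1] True T S eq by auto
  then show ?thesis using above_root assms by blast
next
  case False
  then have lo: "lo T = t" using T by simp
  have hi: "hi S = t - 1"
  proof (rule ccontr)
    assume "hi S \<noteq> t - 1"
    then have h: "t \<le> hi S" using S by simp
    then have "gt S t = gt T t \<or> gt S t = gt T t + 1"
      using gt_Suc[OF assms(1), of "t - 1"] S eq by auto
    moreover have "gt S t \<noteq> gt T t"
      using same_tile[OF assms(1,2), of t] T S h assms(3) by auto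
    ultimately show False using cover1(1)[OF assms(2,1), of t] T S h lo by auto
  qed
  from assms(4) show ?thesis
  proof (cases rule: root_cases)
    case top
    then show ?thesis using hi T root_ge[OF assms(5)] by simp
  next
    case (parent R)
    then have "above 1 R T"
      using aboveI[OF assms(2) parent(1), of t 1] T S eq hi lo_le_hi[of R] by auto
    then show ?thesis using above_root parent assms by blast
  qed
qed

end

text \<open>Walk along \<open>T\<close> from the common last cell to the left. If the tiles parted,
  the left neighbour of the last common cell would lie in a tile of the other tiling with an earlier
  root by \<open>left_root\<close>; such tiles are common to both tilings.\<close>

lemma same_entry_subset:
  assumes "dyck_tiling n \<mu> \<nu> P" "dyck_tiling n \<mu> \<nu>' Q"
    and T: "T \<in> P" and T': "T' \<in> Q" and entry: "entry T = entry T'"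
    and root: "root \<mu> P T j" "root \<mu> Q T' j"
    and PQ: "\<And>i S. i < j \<Longrightarrow> root \<mu> P S i \<Longrightarrow> S \<in> Q"
    and QP: "\<And>i S. i < j \<Longrightarrow> root \<mu> Q S i \<Longrightarrow> S \<in> P"
  shows "T \<subseteq> T'"
proof -
  interpret P: dyck_tiling n \<mu> \<nu> P by fact
  interpret Q: dyck_tiling n \<mu> \<nu>' Q by fact
  have hi: "hi T = hi T'" "gt T (hi T) = gt T' (hi T)"
    using entry by (auto simp: P.entryP Q.entryP T T')
  note le = P.lo_le_hi[OF T] Q.lo_le_hi[OF T']
  have *: "lo T' \<le> t \<and> t \<le> hi T' \<and> gt T' t = gt T t" if t: "t \<le> hi T" "lo T \<le> t" for t
    using t
  proof (induction t rule: int_le_induct)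
    case base
    then show ?case using hi le by simp
  next
    case (step i)
    then have IH: "lo T' \<le> i" "i \<le> hi T'" "gt T' i = gt T i" and lo: "lo T < i" by auto
    have range: "U \<nu> i \<le> gt T i" "U \<nu>' i \<le> gt T i"
      using P.gt_bounds(1)[OF T, of i] Q.gt_bounds(1)[OF T', of i] IH lo step.hyps by auto
    \<comment> \<open>Both tiles contain the cell on antidiagonal \<open>i\<close>, so they coincide
      as soon as one of them occurs in both tilings.\<close>
    have TT': "T = T'" if "T \<in> Q \<or> T' \<in> P"
      using that P.same_tile[of T T' i] Q.same_tile[of T T' i] T T' IH lo step.hyps by auto
    from P.gt_Suc[OF T, of "i - 1"] lo step.hyps
    consider "gt T (i - 1) = gt T i" | "gt T (i - 1) = gt T i - 1" by fastforce
    then show ?case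
    proof cases
      case 1
      \<comment> \<open>\<open>T\<close> continues with the left neighbour. That cell is also above
        the lower path of the other tiling, because paths do not descend to the right, so some tile
        of \<open>Q\<close> covers it.\<close>
      have "gt T i < U \<mu> (i - 1)" using P.gt_bounds(2)[OF T, of "i - 1"] 1 lo step.hyps by auto
      moreover have "U \<nu>' (i - 1) \<le> gt T i" using Q.U_nu_step(1)[of "i - 1"] range by auto
      ultimately obtain S where S: "S \<in> Q" "lo S \<le> i - 1" "i - 1 \<le> hi S" "gt S (i - 1) = gt T i"
        using Q.covered[of "i - 1" "gt T i"] by auto
      have "S = T'"
      proof (rule ccontr)
        assume "S \<noteq> T'"
        obtain k where k: "root \<mu> Q S k" using Q.root_exists S by blast
        have "k < j" using Q.left_root[OF S(1) T' \<open>S \<noteq> T'\<close> k root(2), of i] S IH by auto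
        then have "S \<in> P" using QP k by blast
        then have "S = T" using P.same_tile[of S T "i - 1"] T S lo step.hyps 1 by auto
        then show False using TT' S \<open>S \<noteq> T'\<close> by auto
      qed
      then show ?thesis using S 1 by auto
    next
      case 2
      \<comment> \<open>\<open>T\<close> steps down here. Were \<open>i\<close> the start of
        \<open>T'\<close>, its height would be the common end height, and \<open>T\<close> would
        drop below its own minimum at \<open>i - 1\<close>.\<close>
      have lo': "lo T' \<noteq> i"
        using P.gt_hi[OF T] Q.gt_hi[OF T'] P.gt_ge[OF T, of "i - 1"] IH hi 2 lo step.hyps by auto
      then consider "gt T' (i - 1) = gt T i" | "gt T' (i - 1) = gt T i - 1"
        using Q.gt_Suc[OF T', of "i - 1"] IH by fastforce
      then show ?thesis
      proof cases
        case 1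
        \<comment> \<open>The mirror situation: \<open>T'\<close> takes the left neighbour, which
          must then be covered in \<open>P\<close> by a tile other than \<open>T\<close>.\<close>
        have "gt T i < U \<mu> (i - 1)" using Q.gt_bounds(2)[OF T', of "i - 1"] 1 lo' IH by auto
        moreover have "U \<nu> (i - 1) \<le> gt T i" using P.U_nu_step(1)[of "i - 1"] range by auto
        ultimately obtain S where S: "S \<in> P" "lo S \<le> i - 1" "i - 1 \<le> hi S" "gt S (i - 1) = gt T i"
          using P.covered[of "i - 1" "gt T i"] by auto
        obtain k where k: "root \<mu> P S k" using P.root_exists S by blast
        have "S \<noteq> T" using S 2 by auto
        then have "k < j" using P.left_root[OF S(1) T _ k root(1), of i] S lo step.hyps by auto
        then have "S \<in> Q" using PQ k by blast
        then have "S = T'" using Q.same_tile[of S T' "i - 1"] T' S IH lo' 1 by auto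
        then show ?thesis using TT' S \<open>S \<noteq> T\<close> by auto
      next
        case 2
        then show ?thesis using IH lo' \<open>gt T (i - 1) = _\<close> by auto
      qed
    qed
  qed
  show ?thesis
  proof
    fix c assume "c \<in> T"
    moreover obtain t y where "c = cl t y" using cell_cl by (metis prod.exhaust)
    ultimately show "c \<in> T'" using * by (auto simp: P.mem[OF T] Q.mem[OF T'])
  qed
qed

text \<open>Equal labels make corresponding chains equally long. By induction on the starting step
  and then on the position in the chain, corresponding tiles have equal entries;
  \<open>same_entry_subset\<close> in both directions identifies them.\<close>

lemma tiling_determined:
  assumes "dyck_tiling n \<mu> \<nu> P" "dyck_tiling n \<mu> \<nu>' Q"
    and labels: "\<And>j. j \<in> down_steps \<mu> \<Longrightarrow> psi_label P (step_start \<mu> j) = psi_label Q (step_start \<mu> j)"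
  shows "P = Q"
proof -
  interpret P: dyck_tiling n \<mu> \<nu> P by fact
  interpret Q: dyck_tiling n \<mu> \<nu>' Q by fact
  have chains: "chain P (step_start \<mu> j) k = chain Q (step_start \<mu> j) k" if "j \<in> down_steps \<mu>" for j k
    using that
  proof (induction j arbitrary: k rule: less_induct)
    case (less j)
    let ?e = "step_start \<mu> j"
    have PQ: "S \<in> Q" if "i < j" "root \<mu> P S i" for S i
      using that less.IH[of i] Q.chain_sub unfolding root_def by blast
    have QP: "S \<in> P" if "i < j" "root \<mu> Q S i" for S i
      using that less.IH[of i] P.chain_sub unfolding root_def by blast
    have eq: "T = T'" if "T \<in> chain P ?e k" "T' \<in> chain Q ?e k" "entry T = entry T'" for T T' k
    proof -
      have r: "root \<mu> P T j" "root \<mu> Q T' j" using that less.prems unfolding root_def by blast+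
      have i: "T \<in> P" "T' \<in> Q" using that P.chain_sub Q.chain_sub by blast+
      show ?thesis
      proof
        show "T \<subseteq> T'" using same_entry_subset[OF assms(1,2) i that(3) r PQ QP] .
        show "T' \<subseteq> T" using same_entry_subset[OF assms(2,1) i(2,1) that(3)[symmetric] r(2,1) QP PQ] .
      qed
    qed
    have nonempty: "chain P ?e k = {} \<longleftrightarrow> chain Q ?e k = {}" for k
      using labels[OF less.prems] P.psi_label_iff[of k ?e] Q.psi_label_iff[of k ?e] by auto
    have single: "chain P ?e k = chain Q ?e k"
      if "\<And>T T'. T \<in> chain P ?e k \<Longrightarrow> T' \<in> chain Q ?e k \<Longrightarrow> entry T = entry T'" for k
      using nonempty[of k] eq that P.chain_unique Q.chain_unique by (metis all_not_in_conv subsetI subset_antisym)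
    show ?case
    proof (induction k)
      case 0
      show ?case by (rule single) auto
    next
      case (Suc k)
      show ?case by (rule single) (use Suc P.chain_unique in \<open>auto, metis\<close>)
    qed
  qed
  show ?thesis
    using P.chain_exists Q.chain_exists P.chain_sub Q.chain_sub chains by (metis subsetI subset_antisym)
qed

subsection \<open>Surjectivity\<close>

lemma U_slice:
  assumes "0 \<le> t" "t \<le> int m" "k + m \<le> length p"
  shows "U (take m (drop k p)) t = U p (int k + t) - U p (int k)"
proof -
  have "nat (int k + t) = k + nat t" "nat t \<le> m" using assms by auto
  then have "take (nat (int k + t)) p = take k p @ take (nat t) (take m (drop k p))"
    by (simp add: take_add min_def)
  then show ?thesis by (simp add: U_def ups_def)
qed

text \<open>In terms of heights, the path between the two steps returns to the height reached after
  step \<open>i\<close> and never goes below it.\<close>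

lemma chord_iff:
  "chord p i j \<longleftrightarrow> i < j \<and> j < length p \<and> p ! i \<and> \<not> p ! j \<and>
     2 * U p (int j) - int j = 2 * U p (int i + 1) - (int i + 1) \<and>
     (\<forall>t. int i + 1 \<le> t \<and> t \<le> int j \<longrightarrow> 2 * U p (int i + 1) - (int i + 1) \<le> 2 * U p t - t)"
proof (cases "i < j \<and> j < length p")
  case True
  let ?w = "take (j - i - 1) (drop (i + 1) p)"
  have len: "length ?w = j - i - 1" using True by (simp add: min_absorb2 diff_le_mono)
  have U: "U ?w t = U p (int i + 1 + t) - U p (int i + 1)" if "0 \<le> t" "t \<le> int (j - i - 1)" for t
    using U_slice[of t "j - i - 1" "i + 1" p] that True by (simp add: add.commute)
  have *: "int (ups ?w) = U p (int j) - U p (int i + 1)"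
  proof -
    have "int (ups ?w) = U ?w (int (j - i - 1))" by (rule U_ge_length[symmetric]) (simp only: len order_refl)
    also have "\<dots> = U p (int j) - U p (int i + 1)"
      using U[of "int (j - i - 1)"] True by (simp add: of_nat_diff)
    finally show ?thesis .
  qed
  have "(\<forall>t. 0 \<le> t \<and> t \<le> int (length ?w) \<longrightarrow> t \<le> 2 * U ?w t) \<longleftrightarrow>
    (\<forall>t. int i + 1 \<le> t \<and> t \<le> int j \<longrightarrow> 2 * U p (int i + 1) - (int i + 1) \<le> 2 * U p t - t)"
    (is "?l = ?r")
  proof
    assume ?l
    show ?r
    proof (intro allI impI)
      fix t assume t: "int i + 1 \<le> t \<and> t \<le> int j"
      then have "t - (int i + 1) \<le> 2 * U ?w (t - (int i + 1))"
        using \<open>?l\<close> len True by (simp add: of_nat_diff)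
      then show "2 * U p (int i + 1) - (int i + 1) \<le> 2 * U p t - t"
        using U[of "t - (int i + 1)"] t True by (simp add: of_nat_diff)
    qed
  next
    assume ?r
    show ?l
    proof (intro allI impI)
      fix t assume t: "0 \<le> t \<and> t \<le> int (length ?w)"
      then show "t \<le> 2 * U ?w t"
        using U[of t] \<open>?r\<close>[rule_format, of "int i + 1 + t"] len True by (simp add: of_nat_diff)
    qed
  qed
  moreover have "2 * int (ups ?w) = int (length ?w) \<longleftrightarrow>
      2 * U p (int j) - int j = 2 * U p (int i + 1) - (int i + 1)"
    using * len True by (auto simp: of_nat_diff)
  ultimately show ?thesis using True unfolding chord_def dyck_word_iff by blast
qed (auto simp: chord_def)

text \<open>The partner is the last earlier point lower than the start of step \<open>j\<close>; the
  origin is such a point because a down step starts at positive height.\<close>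

lemma chord_exists:
  assumes p: "p \<in> dyck_paths n" and j: "j \<in> down_steps p"
  shows "\<exists>i. chord p i j"
proof -
  let ?h = "\<lambda>t. 2 * U p t - t"
  have j': "j < length p" "\<not> p ! j" using j by (auto simp: down_steps_def)
  have "int j + 1 \<le> 2 * U p (int j + 1)"
    using dyck_pathsD(3)[OF p, of "int j + 1"] dyck_pathsD(1)[OF p] j' by auto
  then have hj: "1 \<le> ?h (int j)" using U_int_Suc[OF j'(1)] j' by auto
  define A where "A = {k. k \<le> j \<and> ?h (int k) < ?h (int j)}"
  have A: "finite A" "0 \<in> A" using hj by (auto simp: A_def)
  define i where "i = Max A"
  have "i \<in> A" unfolding i_def using A by (intro Max_in) auto
  then have i: "i < j" "?h (int i) < ?h (int j)" unfolding A_def using order.order_iff_strict by auto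
  have ge: "?h (int j) \<le> ?h t" if "int i + 1 \<le> t" "t \<le> int j" for t
  proof (rule ccontr)
    assume "\<not> ?h (int j) \<le> ?h t"
    then have "nat t \<in> A" using that by (auto simp: A_def)
    then have "nat t \<le> i" unfolding i_def using A by (intro Max_ge) auto
    then show False using that by auto
  qed
  have "i < length p" using i j' by auto
  then have "p ! i" "?h (int i + 1) = ?h (int j)"
    using ge[of "int i + 1"] i U_int_Suc[of i p] by (auto split: if_splits)
  then show ?thesis using i j' ge by (auto simp: chord_iff)
qed

text \<open>The later of two candidates would start one unit below the floor of the chord of the
  earlier one.\<close>

lemma chord_unique:
  assumes "chord p i j" "chord p i' j" shows "i = i'"
proof -
  have False if "chord p a j" "chord p b j" "a < b" for a b
    using that U_int_Suc[of b p] unfolding chord_iff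
    by (elim conjE allE[of _ "int b"]) auto
  then show ?thesis using assms by (metis linorder_neqE_nat)
qed

text \<open>The up step of the chord ends at the height where the down step starts, which accounts
  for the \<open>+ 1\<close> in \<open>ht\<close>.\<close>

lemma ht_eq:
  assumes p: "p \<in> dyck_paths n" and j: "j \<in> down_steps p"
  shows "int (ht p j) = hgt (step_start p j)"
proof -
  obtain i where i: "chord p i j" using chord_exists[OF assms] by blast
  then have THE: "(THE i. chord p i j) = i" using chord_unique by blast
  have c: "i < j" "j < length p" "p ! i" "2 * U p (int j) - int j = 2 * U p (int i + 1) - (int i + 1)"
    using i unfolding chord_iff by auto
  then have "int (downs (take i p)) = int i - U p (int i)" "int (ups (take i p)) = U p (int i)"
    using downs_take[of i p] by (auto simp: U_def)
  moreover have "int i \<le> 2 * U p (int i)"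
    using dyck_pathsD(3)[OF p, of "int i"] dyck_pathsD(1)[OF p] c by auto
  ultimately have "int (ht p j) = 2 * U p (int i) - int i + 1"
    unfolding ht_def THE Let_def by (simp add: of_nat_diff)
  then show ?thesis using c U_int_Suc[of i p] by (simp add: step_start_ed)
qed

lemma U_swap:
  assumes "chord p i s"
  shows "U (p[i := False, s := True]) t = U p t - (if int i < t \<and> t \<le> int s then 1 else 0)"
proof -
  have c: "i < s" "s < length p" "p ! i" "\<not> p ! s" using assms by (auto simp: chord_def)
  have "U (p[i := False, s := True]) (int k) = U p (int k) - (if i < k \<and> k \<le> s then 1 else 0)" for k
  proof (induction k)
    case (Suc k)
    have *: "int (Suc k) = int k + 1" by simp
    show ?case unfolding * U_Suc using Suc c by (auto simp: nth_list_update)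
  qed simp
  from this[of "nat t"] show ?thesis by (cases "0 \<le> t") auto
qed

section \<open>Adding one tile below the lower path\<close>

text \<open>Of the conditions for adding a tile at a chord, \<open>height\<close> keeps the lowered
  path above the diagonal, \<open>parallel\<close> says that \<nu> runs parallel to every tile along
  its interval, and \<open>free\<close> that no tile continues across step \<open>s\<close>.\<close>

locale dyck_tiling_chord = dyck_tiling +
  fixes i s :: nat
  assumes chord: "chord \<nu> i s" and height: "2 \<le> hgt (step_start \<nu> s)"
    and parallel: "T \<in> P \<Longrightarrow> \<exists>m. \<forall>t. lo T \<le> t \<and> t \<le> hi T \<longrightarrow> U \<nu> t = gt T t - m"
    and free: "T \<in> P \<Longrightarrow> \<not> (lo T \<le> int s \<and> int s < hi T)"
begin

definition \<nu>' :: "bool list" where "\<nu>' = \<nu>[i := False, s := True]"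
text \<open>The cells directly below \<nu> strictly inside the chord (\<open>L_params\<close>); the
  lower left corner of the first one is the start of step \<open>i\<close>.\<close>

definition L :: "cell set" where "L = set (path_cells (step_start \<nu> i) (take (s - i - 1) (drop (i + 1) \<nu>)))"
abbreviation P' :: "cell set set" where "P' \<equiv> insert L P"

lemma ends: "i < s" "s < length \<nu>" "\<nu> ! i" "\<not> \<nu> ! s"
  using chord by (auto simp: chord_def)

lemma U_i: "U \<nu> (int i + 1) = U \<nu> (int i) + 1"
  using U_int_Suc[of i \<nu>] ends by auto

lemma chord_heights:
  "2 * U \<nu> (int s) - int s = 2 * U \<nu> (int i + 1) - (int i + 1)"
  "int i + 1 \<le> t \<Longrightarrow> t \<le> int s \<Longrightarrow> 2 * U \<nu> (int i + 1) - (int i + 1) \<le> 2 * U \<nu> t - t"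
  using chord unfolding chord_iff by blast+

lemma U_nu': "U \<nu>' t = U \<nu> t - (if int i < t \<and> t \<le> int s then 1 else 0)"
  unfolding \<nu>'_def by (rule U_swap[OF chord])

lemma length_nu: "length \<nu> = 2 * n"
  by (rule dyck_pathsD[OF nu])

lemma nu'_dyck: "\<nu>' \<in> dyck_paths n"
proof -
  have l: "length \<nu>' = 2 * n" by (simp add: \<nu>'_def length_nu)
  have "int (ups \<nu>') = U \<nu>' (2 * int n)" using U_ge_length[of \<nu>' "2 * int n"] l by simp
  also have "\<dots> = int n" using ends length_nu dyck_pathsD(4)[OF nu, of "2 * int n"] by (simp add: U_nu')
  finally have "ups \<nu>' = n" by simp
  \<comment> \<open>Lowering the ordinate by one costs height 2, and inside the chord the height is
    at least that of step \<open>s\<close>.\<close>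
  moreover have "t \<le> 2 * U \<nu>' t" if "0 \<le> t" "t \<le> 2 * int n" for t
    using dyck_pathsD(3)[OF nu that] chord_heights(1) chord_heights(2)[of t] height ends by (auto simp: U_nu' step_start_ed)
  ultimately show ?thesis using l by (simp add: dyck_paths_def dyck_word_iff)
qed

lemma L_tile: "tile L (int i + 1) (int s) (\<lambda>t. U \<nu> t - 1)"
proof -
  let ?w = "take (s - i - 1) (drop (i + 1) \<nu>)"
  have start: "step_start \<nu> i = cl (int i + 1) (U \<nu> (int i))"
    using ends by (simp add: step_start_ed) (simp add: ed_def cl_def)
  have w: "dyck_word ?w" using chord by (simp add: chord_def)
  have len: "int (length ?w) = int s - int i - 1" using ends by auto
  have e: "int i + 1 + int (length ?w) = int s" using len by simp
  have t: "tile L (int i + 1) (int s) (\<lambda>t. U \<nu> (int i) + U ?w (t - (int i + 1)))"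
    unfolding L_def start using tile_path_cells[OF w, of "int i + 1" "U \<nu> (int i)"] unfolding e .
  have g: "U \<nu> (int i) + U ?w (t - (int i + 1)) = U \<nu> t - 1" if "int i + 1 \<le> t" "t \<le> int s" for t
    using U_slice[of "t - (int i + 1)" "s - i - 1" "i + 1" \<nu>] that ends U_i by (simp add: add.commute of_nat_diff)
  have "(\<lambda>t. cl t (U \<nu> (int i) + U ?w (t - (int i + 1)))) ` {int i + 1..int s} =
      (\<lambda>t. cl t (U \<nu> t - 1)) ` {int i + 1..int s}"
    by (intro image_cong refl) (use g in auto)
  moreover have "L = (\<lambda>t. cl t (U \<nu> (int i) + U ?w (t - (int i + 1)))) ` {int i + 1..int s}"
    using t unfolding tile_def by blast
  ultimately have "L = (\<lambda>t. cl t (U \<nu> t - 1)) ` {int i + 1..int s}" by simp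
  then show ?thesis
    unfolding tile_def using ends chord_heights U_Suc[of \<nu>] by (auto split: if_splits)
qed

lemma L_dyck: "dyck_tile L"
  using chord unfolding L_def dyck_tile_def chord_def by blast

lemma L_params: "lo L = int i + 1" "hi L = int s" "int i + 1 \<le> t \<Longrightarrow> t \<le> int s \<Longrightarrow> gt L t = U \<nu> t - 1"
  using tile_unique[OF L_tile dyck_tile_params[OF L_dyck]] by auto

lemma L_mem: "cl t y \<in> L \<longleftrightarrow> int i + 1 \<le> t \<and> t \<le> int s \<and> y = U \<nu> t - 1"
  using tile_mem[OF L_tile] .

text \<open>By \<open>free\<close>, a tile can only stick out of the chord on the left. By
  \<open>parallel\<close>, \<nu> would then be no higher at the end of the tile than before step
  \<open>i\<close>, although inside a chord it is strictly higher.\<close>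

lemma laminar:
  assumes "T \<in> P" shows "hi T \<le> int i \<or> int s < lo T \<or> int i + 1 \<le> lo T \<and> hi T \<le> int s"
proof (rule ccontr)
  assume neg: "\<not> ?thesis"
  then have hs: "hi T \<le> int s" using free[OF assms] lo_le_hi[OF assms] by auto
  then have l: "lo T \<le> int i" "int i < hi T" using neg by auto
  obtain m where m: "\<And>t. lo T \<le> t \<Longrightarrow> t \<le> hi T \<Longrightarrow> U \<nu> t = gt T t - m" using parallel[OF assms] by blast
  have "2 * U \<nu> (hi T) - hi T \<le> 2 * U \<nu> (int i) - int i"
    using gt_ge[OF assms, of "int i"] gt_hi[OF assms] m[of "int i"] m[of "hi T"] l by auto
  then show False using chord_heights(2)[of "hi T"] l hs U_i by auto
qed

lemma L_disjoint: "T \<in> P \<Longrightarrow> T \<inter> L = {}"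
proof (rule ccontr)
  assume T: "T \<in> P" "T \<inter> L \<noteq> {}"
  then obtain c where c: "c \<in> T" "c \<in> L" by blast
  obtain t y where "c = cl t y" using cell_cl by (metis prod.exhaust)
  then show False using c gt_bounds[OF T(1), of t] by (simp add: mem[OF T(1)] L_mem)
qed

lemma skew_cells_nu': "skew_cells \<nu>' \<mu> = L \<union> skew_cells \<nu> \<mu>"
proof -
  have "cl t y \<in> skew_cells \<nu>' \<mu> \<longleftrightarrow> cl t y \<in> L \<union> skew_cells \<nu> \<mu>" for t y
    using skew_cells_iff[OF nu'_dyck mu, of t y] skew_cells_iff[OF nu mu, of t y] U_nu'[of t] U_nu_le[of t]
    by (auto simp: L_mem)
  then show ?thesis by (auto) (metis cell_cl Un_iff)+
qed

text \<open>\<open>L\<close> lies below all old tiles, so the only new case is an old tile directly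
  above \<open>L\<close>.\<close>

lemma cover_inclusive_P': "cover_inclusive P'"
  unfolding cover_inclusive_def
proof (intro ballI impI)
  fix T1 T2 assume T: "T1 \<in> P'" "T2 \<in> P'" and "\<exists>c\<in>T2. shift c \<in> T1"
  then obtain c where c: "c \<in> T2" "shift c \<in> T1" by blast
  obtain t y where ty: "c = cl t y" using cell_cl by (metis prod.exhaust)
  show "shift ` T2 \<subseteq> T1"
  proof (cases "T1 \<in> P")
    case T1: True
    show ?thesis
    proof (cases "T2 \<in> P")
      case True
      then show ?thesis using T1 c P_unfold(4) unfolding cover_inclusive_def by blast
    next
      case False
      then have "T2 = L" using T by simp
      then show ?thesis using c ty gt_bounds[OF T1, of t] by (simp add: mem[OF T1] L_mem)
    qed
  next
    case False
    then have T1: "T1 = L" using T by simp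
    have "T2 \<noteq> L" using c unfolding T1 ty by (auto simp: L_mem)
    then have T2: "T2 \<in> P" using T by simp
    obtain m where m: "\<And>t. lo T2 \<le> t \<Longrightarrow> t \<le> hi T2 \<Longrightarrow> U \<nu> t = gt T2 t - m"
      using parallel[OF T2] by blast
    have t: "lo T2 \<le> t" "t \<le> hi T2" "int i + 1 \<le> t" "t \<le> int s" "y = gt T2 t" "y = U \<nu> t"
      using c unfolding T1 ty by (auto simp: L_mem mem[OF T2])
    \<comment> \<open>\<open>T2\<close> rests on \<nu> at one antidiagonal, hence by parallelism
      everywhere; with \<open>laminar\<close>, its whole translate falls into
      \<open>L\<close>.\<close>
    then have "m = 0" using m[of t] by simp
    moreover have "int i + 1 \<le> lo T2" "hi T2 \<le> int s" using laminar[OF T2] t by auto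
    ultimately have "cl u v \<in> T2 \<Longrightarrow> shift (cl u v) \<in> L" for u v
      using m[of u] by (auto simp: L_mem mem[OF T2])
    then show ?thesis unfolding T1 by (metis cell_cl image_subsetI prod.exhaust)
  qed
qed

sublocale new: dyck_tiling n \<mu> \<nu>' P'
proof
  have "weakly_above \<mu> \<nu>'"
    unfolding weakly_above_iff[OF nu'_dyck mu]
  proof
    fix t show "U \<nu>' t \<le> U \<mu> t" using U_nu_le[of t] by (simp add: U_nu')
  qed
  moreover have "\<Union>P' = skew_cells \<nu>' \<mu>" using P_unfold(1) by (simp add: skew_cells_nu')
  moreover have "\<forall>T\<in>P'. dyck_tile T" using P_unfold(2) L_dyck by blast
  moreover have "\<forall>T1\<in>P'. \<forall>T2\<in>P'. T1 \<noteq> T2 \<longrightarrow> T1 \<inter> T2 = {}" using P_unfold(3) L_disjoint by blast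
  ultimately show "P' \<in> dyck_tilings \<nu>' \<mu>"
    using cover_inclusive_P' by (simp add: dyck_tilings_def)
qed (use mu nu'_dyck in auto)

lemma entry_L: "entry L = step_start \<nu> s"
  using tile_entry[OF L_tile] ends by (simp add: step_start_ed)

lemma exit_L: "exit L = step_start \<nu>' i"
  using tile_exit[OF L_tile] ends U_i by (simp add: step_start_ed \<nu>'_def) (simp flip: \<nu>'_def add: U_nu')

lemma chain_old: "chain P e k \<subseteq> chain P' e k"
  by (induction k) auto

lemma iterate_old:
  "k \<le> psi_label P e \<Longrightarrow> (next_edge P' ^^ k) e = (next_edge P ^^ k) e"
proof (induction k)
  case (Suc k)
  then obtain T where T: "T \<in> chain P e k" using psi_label_iff[of k e] by auto
  moreover have "T \<in> chain P' e k" using T chain_old by blast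
  ultimately show ?case using chain_next[OF T] new.chain_next[of T e k] by metis
qed simp

text \<open>A tile entered at the last edge would prolong the chain.\<close>

lemma last_not_entry: "T \<in> P \<Longrightarrow> entry T \<noteq> (next_edge P ^^ psi_label P e) e"
proof
  assume T: "T \<in> P" "entry T = (next_edge P ^^ psi_label P e) e"
  have "\<exists>T\<in>P. entry T = (next_edge P ^^ i) e" if i: "i \<le> psi_label P e" for i
  proof (cases "i = psi_label P e")
    case False
    then obtain S where S: "S \<in> chain P e i" using i psi_label_iff[of i e] by auto
    then show ?thesis using chain_next[OF S] chain_sub[OF S] by auto
  qed (use T in auto)
  then show False using chain_iff[of "psi_label P e" e] psi_label_iff[of "psi_label P e" e] by auto
qed

text \<open>Old chains survive, and the only new entry is at step \<open>s\<close> of \<nu>, so a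
  chain ending elsewhere is not continued.\<close>

lemma label_other:
  assumes "(next_edge P ^^ psi_label P e) e \<noteq> step_start \<nu> s"
  shows "psi_label P' e = psi_label P e"
proof (rule antisym)
  have "chain P' e (psi_label P e) = {}"
  proof (rule equals0I)
    fix T assume T: "T \<in> chain P' e (psi_label P e)"
    then have "entry T = (next_edge P ^^ psi_label P e) e"
      using new.chain_next[OF T] iterate_old[of "psi_label P e" e] by simp
    then show False using new.chain_sub[OF T] last_not_entry[of T e] assms entry_L by auto
  qed
  then show "psi_label P' e \<le> psi_label P e"
    using new.psi_label_iff[of "psi_label P e" e] by simp
  show "psi_label P e \<le> psi_label P' e"
  proof (rule ccontr)
    assume "\<not> ?thesis"
    then show False using psi_label_iff[of "psi_label P' e" e] new.psi_label_iff[of "psi_label P' e" e] chain_old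
      by fastforce
  qed
qed

lemma label_this:
  assumes "(next_edge P ^^ psi_label P e) e = step_start \<nu> s"
  shows "psi_label P' e = Suc (psi_label P e)"
    and "(next_edge P' ^^ psi_label P' e) e = step_start \<nu>' i"
proof -
  let ?l = "psi_label P e"
  have "\<exists>T\<in>P'. entry T = (next_edge P' ^^ k) e" if k: "k \<le> ?l" for k
  proof (cases "k = ?l")
    case True
    then show ?thesis using assms iterate_old[of ?l e] entry_L by auto
  next
    case False
    then obtain S where S: "S \<in> chain P e k" using k psi_label_iff[of k e] by auto
    then have "S \<in> chain P' e k" using chain_old by blast
    then show ?thesis using new.chain_next new.chain_sub by metis
  qed
  then obtain T where T: "T \<in> chain P' e ?l" using new.chain_iff[of ?l e] by auto
  then have "entry T = entry L" using new.chain_next[OF T] iterate_old[of ?l e] assms entry_L by simp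
  then have "T = L" using new.entry_inj[of T L] new.chain_sub[OF T] by simp
  then have ex: "(next_edge P' ^^ Suc ?l) e = exit L" using new.chain_next[OF T] by metis
  \<comment> \<open>The chain stops after \<open>L\<close>: a tile entered at the exit of
    \<open>L\<close> would have its last cell below \<nu>, and \<open>L\<close> itself ends further
    right.\<close>
  have "chain P' e (Suc ?l) = {}"
  proof (rule equals0I)
    fix R assume R: "R \<in> chain P' e (Suc ?l)"
    then have eq: "entry R = exit L" and "R \<in> P'" using new.chain_next[OF R] ex new.chain_sub[OF R] by auto
    then have R: "hi R = int i" "gt R (int i) + 1 = U \<nu> (int i)"
      using new.entryP[of R] new.exitP[of L] L_params(1) L_params(3)[of "int i + 1"] ends U_i by auto
    show False
    proof (cases "R = L")
      case True
      then show ?thesis using R(1) L_params ends by simp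
    next
      case False
      then show ?thesis using \<open>R \<in> P'\<close> R gt_bounds(1)[of R "int i"] lo_le_hi[of R] by auto
    qed
  qed
  then show "psi_label P' e = Suc ?l"
    using new.psi_label_iff[of "Suc ?l" e] new.psi_label_iff[of ?l e] T by force
  then show "(next_edge P' ^^ psi_label P' e) e = step_start \<nu>' i" using ex exit_L by simp
qed

end


text \<open>The last condition says that the chain starting at a down step beyond all positive labels
  ends on the lower path, at a step that is free to be the right end of the next tile.\<close>
definition realizes :: "nat \<Rightarrow> bool list \<Rightarrow> (nat \<Rightarrow> nat) \<Rightarrow> bool list \<Rightarrow> cell set set \<Rightarrow> bool" where
  "realizes n \<mu> H \<nu> P \<longleftrightarrow> dyck_tiling n \<mu> \<nu> P \<and>
     (\<forall>j\<in>down_steps \<mu>. psi_label P (step_start \<mu> j) = H j) \<and>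
     (\<forall>T\<in>P. \<exists>m. \<forall>t. lo T \<le> t \<and> t \<le> hi T \<longrightarrow> U \<nu> t = gt T t - m) \<and>
     (\<forall>K. (\<forall>j\<in>down_steps \<mu>. K \<le> j \<longrightarrow> H j = 0) \<longrightarrow>
        (\<forall>t\<ge>int K. U \<nu> t = U \<mu> t) \<and> (\<forall>T\<in>P. hi T < int K)) \<and>
     (\<forall>j\<in>down_steps \<mu>. (\<forall>j'\<in>down_steps \<mu>. j < j' \<longrightarrow> H j' = 0) \<longrightarrow>
        (\<exists>s\<in>down_steps \<nu>. s \<le> j \<and> (next_edge P ^^ H j) (step_start \<mu> j) = step_start \<nu> s \<and>
           (\<forall>T\<in>P. \<not> (lo T \<le> int s \<and> int s < hi T))))"

lemma realizes_zero:
  assumes mu: "\<mu> \<in> dyck_paths n" and H: "\<And>j. j \<in> down_steps \<mu> \<Longrightarrow> H j = 0"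
  shows "realizes n \<mu> H \<mu> {}"
proof -
  have "cl t y \<notin> skew_cells \<mu> \<mu>" for t y using skew_cells_iff[OF mu mu] by auto
  then have "skew_cells \<mu> \<mu> = {}" by (metis cell_cl equals0I prod.exhaust)
  then have "{} \<in> dyck_tilings \<mu> \<mu>"
    using weakly_above_iff[OF mu mu] by (auto simp: dyck_tilings_def cover_inclusive_def)
  then have "dyck_tiling n \<mu> \<mu> {}" using mu by unfold_locales
  then show ?thesis using H by (auto simp: realizes_def psi_label_def Least_eq_0)
qed

text \<open>Raises the label of \<open>J\<close>, the last down step with a positive label, by
  adding one tile at the end of its chain. The rest of the proof checks that the invariant
  survives.\<close>

lemma realizes_step:
  assumes mu: "\<mu> \<in> dyck_paths n" and real: "realizes n \<mu> (H(J := h)) \<nu> P"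
    and J: "J \<in> down_steps \<mu>" "H J = Suc h" "H J < ht \<mu> J"
    and zero: "\<And>j. j \<in> down_steps \<mu> \<Longrightarrow> J < j \<Longrightarrow> H j = 0"
  shows "\<exists>\<nu>' P'. realizes n \<mu> H \<nu>' P'"
proof -
  let ?H = "H(J := h)"
  note R = real[unfolded realizes_def]
  note t = R[THEN conjunct1] and lab = R[THEN conjunct2, THEN conjunct1, rule_format]
    and par = R[THEN conjunct2, THEN conjunct2, THEN conjunct1, THEN bspec]
    and right = R[THEN conjunct2, THEN conjunct2, THEN conjunct2, THEN conjunct1, THEN spec, THEN mp]
    and last = R[THEN conjunct2, THEN conjunct2, THEN conjunct2, THEN conjunct2, THEN bspec, THEN mp]
  interpret dyck_tiling n \<mu> \<nu> P by (rule t)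
  let ?e = "step_start \<mu> J"
  have "\<forall>j'\<in>down_steps \<mu>. J < j' \<longrightarrow> ?H j' = 0" using zero by auto
  from last[OF J(1) this] obtain s where s: "s \<in> down_steps \<nu>" "s \<le> J"
     "(next_edge P ^^ h) ?e = step_start \<nu> s" "\<And>T. T \<in> P \<Longrightarrow> \<not> (lo T \<le> int s \<and> int s < hi T)"
    by auto
  have lJ: "psi_label P ?e = h" using lab[OF J(1)] by simp
  \<comment> \<open>After \<open>h\<close> jumps the height is \<open>ht \<mu> J - h\<close>; since
    \<open>h + 1 < ht \<mu> J\<close>, this leaves the height 2 demanded by
    \<open>dyck_tiling_chord\<close>.\<close>
  have "hgt ((next_edge P ^^ h) ?e) = hgt ?e - int h"
  proof (cases h)
    case (Suc k)
    then obtain T where T: "T \<in> chain P ?e k" using psi_label_iff[of k ?e] lJ by auto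
    then have "(next_edge P ^^ h) ?e = exit T" using chain_next[OF T] Suc by metis
    then show ?thesis using chain_hgt[OF T] Suc by simp
  qed simp
  then have hs: "2 \<le> hgt (step_start \<nu> s)" using s(3) J(2,3) ht_eq[OF mu J(1)] by auto
  obtain i where i: "chord \<nu> i s" using chord_exists[OF nu s(1)] by blast
  interpret dyck_tiling_chord n \<mu> \<nu> P i s
  proof unfold_locales
    show "chord \<nu> i s" by (rule i)
    show "2 \<le> hgt (step_start \<nu> s)" by (rule hs)
  qed (use par s(4) in blast)+
  have end_J: "(next_edge P ^^ psi_label P ?e) ?e = step_start \<nu> s" using s(3) lJ by simp
  have labels: "psi_label P' (step_start \<mu> j) = H j" if j: "j \<in> down_steps \<mu>" for j
  proof (cases "j = J")
    case True
    then show ?thesis using label_this(1)[OF end_J] lJ J by simp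
  next
    case False
    \<comment> \<open>Different chains have different last edges, so only the chain of
      \<open>J\<close> ends at step \<open>s\<close>.\<close>
    then have "(next_edge P ^^ psi_label P (step_start \<mu> j)) (step_start \<mu> j) \<noteq> step_start \<nu> s"
      using edge_unique[OF j J(1) order_refl order_refl] end_J by auto
    then show ?thesis using label_other lab[OF j] False by simp
  qed
  \<comment> \<open>By \<open>laminar\<close>, \<nu> is lowered along the whole interval of an old
    tile or nowhere on it, so the offset becomes \<open>m + 1\<close> or stays
    \<open>m\<close>.\<close>
  have parallel': "\<exists>m. \<forall>t. lo T \<le> t \<and> t \<le> hi T \<longrightarrow> U \<nu>' t = gt T t - m" if T: "T \<in> P'" for T
  proof (cases "T = L")
    case True
    then show ?thesis by (intro exI[of _ 0]) (auto simp: L_params U_nu')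
  next
    case False
    then have TP: "T \<in> P" using T by simp
    then obtain m where m: "\<And>t. lo T \<le> t \<Longrightarrow> t \<le> hi T \<Longrightarrow> U \<nu> t = gt T t - m" using par by blast
    from laminar[OF TP] show ?thesis
    proof (elim disjE conjE)
      assume "hi T \<le> int i" then show ?thesis using m by (intro exI[of _ m]) (auto simp: U_nu')
    next
      assume "int s < lo T" then show ?thesis using m by (intro exI[of _ m]) (auto simp: U_nu')
    next
      assume "int i + 1 \<le> lo T" "hi T \<le> int s"
      then show ?thesis using m by (intro exI[of _ "m + 1"]) (auto simp: U_nu')
    qed
  qed
  \<comment> \<open>Everything from \<open>K\<close> on is unchanged, because the chord ends at
    \<open>s \<le> J < K\<close>.\<close>
  have right': "(\<forall>t\<ge>int K. U \<nu>' t = U \<mu> t) \<and> (\<forall>T\<in>P'. hi T < int K)"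
    if K: "\<forall>j\<in>down_steps \<mu>. K \<le> j \<longrightarrow> H j = 0" for K
  proof -
    have "J < K" using K J by (metis linorder_not_less nat.distinct(1))
    moreover have "\<forall>j\<in>down_steps \<mu>. K \<le> j \<longrightarrow> ?H j = 0" using K calculation by auto
    ultimately show ?thesis using right[of K] s(2) by (auto simp: U_nu' L_params)
  qed
  \<comment> \<open>For \<open>J\<close> the chain now ends at step \<open>i\<close>, which
    \<open>laminar\<close> shows to be free. A later down step has label 0 and lies to the right of
    all tiles, where \<nu>' still agrees with \<mu>.\<close>
  have last': "\<exists>r\<in>down_steps \<nu>'. r \<le> j \<and> (next_edge P' ^^ H j) (step_start \<mu> j) = step_start \<nu>' r \<and>
           (\<forall>T\<in>P'. \<not> (lo T \<le> int r \<and> int r < hi T))"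
    if j: "j \<in> down_steps \<mu>" and zero_j: "\<forall>j'\<in>down_steps \<mu>. j < j' \<longrightarrow> H j' = 0" for j
  proof -
    have "J \<le> j" using zero_j J by (metis linorder_not_less nat.distinct(1))
    then consider "j = J" | "J < j" by linarith
    then show ?thesis
    proof cases
      case 1
      have "i \<in> down_steps \<nu>'" using ends by (auto simp: down_steps_def \<nu>'_def)
      moreover have "(next_edge P' ^^ H J) ?e = step_start \<nu>' i"
        using label_this(2)[OF end_J] labels[OF J(1)] by simp
      moreover have "\<not> (lo T \<le> int i \<and> int i < hi T)" if "T \<in> P'" for T
        using that laminar[of T] ends by (auto simp: L_params)
      ultimately show ?thesis using 1 ends s(2) by (intro bexI[of _ i]) auto
    next
      case 2
      have "H j = 0" using zero[OF j 2] .
      have r: "(\<forall>t\<ge>int j. U \<nu>' t = U \<mu> t) \<and> (\<forall>T\<in>P'. hi T < int j)"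
        if "\<forall>j'\<in>down_steps \<mu>. j \<le> j' \<longrightarrow> H j' = 0" using right' that .
      have z: "\<forall>j'\<in>down_steps \<mu>. j \<le> j' \<longrightarrow> H j' = 0" using zero_j \<open>H j = 0\<close> by (metis le_neq_implies_less)
      have jl: "j < length \<mu>" "length \<mu> = length \<nu>'" "\<not> \<mu> ! j"
        using j length_nu dyck_pathsD(1)[OF mu] by (auto simp: down_steps_def \<nu>'_def)
      then have "\<not> \<nu>' ! j" using r[OF z] U_int_Suc[of j \<mu>] U_int_Suc[of j \<nu>'] by auto
      then show ?thesis using r[OF z] jl \<open>H j = 0\<close>
        by (intro bexI[of _ j]) (auto simp: step_start_ed down_steps_def)
    qed
  qed
  have "realizes n \<mu> H \<nu>' P'"
    unfolding realizes_def
  proof (intro conjI)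
    show "dyck_tiling n \<mu> \<nu>' P'" by (rule new.dyck_tiling_axioms)
    show "\<forall>j\<in>down_steps \<mu>. psi_label P' (step_start \<mu> j) = H j" using labels by blast
    show "\<forall>T\<in>P'. \<exists>m. \<forall>t. lo T \<le> t \<and> t \<le> hi T \<longrightarrow> U \<nu>' t = gt T t - m"
      using parallel' by blast
    show "\<forall>K. (\<forall>j\<in>down_steps \<mu>. K \<le> j \<longrightarrow> H j = 0) \<longrightarrow>
        (\<forall>t\<ge>int K. U \<nu>' t = U \<mu> t) \<and> (\<forall>T\<in>P'. hi T < int K)"
      by (intro allI impI right')
    show "\<forall>j\<in>down_steps \<mu>. (\<forall>j'\<in>down_steps \<mu>. j < j' \<longrightarrow> H j' = 0) \<longrightarrow>
        (\<exists>r\<in>down_steps \<nu>'. r \<le> j \<and> (next_edge P' ^^ H j) (step_start \<mu> j) = step_start \<nu>' r \<and>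
           (\<forall>T\<in>P'. \<not> (lo T \<le> int r \<and> int r < hi T)))"
      by (intro ballI impI, rule last') assumption+
  qed
  then show ?thesis by blast
qed

text \<open>Induction on the sum of the labels: the last positive label is lowered by one and
  restored by \<open>realizes_step\<close>. Unwound, this fills the chains from left to
  right.\<close>

lemma realizes_exists:
  assumes "\<mu> \<in> dyck_paths n" "\<And>j. j \<in> down_steps \<mu> \<Longrightarrow> H j < ht \<mu> j"
  shows "\<exists>\<nu> P. realizes n \<mu> H \<nu> P"
  using assms(2)
proof (induction "sum H (down_steps \<mu>)" arbitrary: H rule: less_induct)
  case less
  have fin: "finite (down_steps \<mu>)" by (simp add: down_steps_def)
  show ?case
  proof (cases "\<forall>j\<in>down_steps \<mu>. H j = 0")
    case True
    then show ?thesis using realizes_zero[OF assms(1), of H] by blast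
  next
    case False
    define A where "A = {j \<in> down_steps \<mu>. H j \<noteq> 0}"
    define J where "J = Max A"
    have A: "finite A" "A \<noteq> {}" using False fin by (auto simp: A_def)
    have J: "J \<in> down_steps \<mu>" "H J \<noteq> 0" using Max_in[OF A] by (auto simp: A_def J_def)
    have zero: "H j = 0" if "j \<in> down_steps \<mu>" "J < j" for j
      using that Max_ge[OF A(1), of j] by (fastforce simp: A_def J_def)
    obtain h where h: "H J = Suc h" using J(2) not0_implies_Suc by blast
    let ?H = "H(J := h)"
    have "sum ?H (down_steps \<mu>) < sum H (down_steps \<mu>)"
      by (rule sum_strict_mono_ex1[OF fin]) (use h J in auto)
    moreover have "?H j < ht \<mu> j" if "j \<in> down_steps \<mu>" for j
      using less.prems[OF that] h by auto
    ultimately obtain \<nu> P where "realizes n \<mu> ?H \<nu> P" using less.hyps[of ?H] by blast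
    then show ?thesis using realizes_step[OF assms(1), of H J h \<nu> P] J(1) h less.prems[OF J(1)] zero by blast
  qed
qed

section \<open>The bijection \<open>psi\<close> and the number of tiles\<close>

lemma tilings_star_iff:
  assumes "\<mu> \<in> dyck_paths n"
  shows "P \<in> tilings_star \<mu> \<longleftrightarrow> (\<exists>\<nu>. dyck_tiling n \<mu> \<nu> P)"
proof -
  have "length \<mu> div 2 = n" using dyck_pathsD(1)[OF assms] by simp
  then show ?thesis using assms by (simp add: tilings_star_def dyck_tiling_def Bex_def)
qed

lemma psi_bij:
  assumes mu: "\<mu> \<in> dyck_paths n"
  shows "bij_betw (psi \<mu>) (tilings_star \<mu>) (HH \<mu>)"
proof (rule bij_betwI')
  fix P Q assume "P \<in> tilings_star \<mu>" "Q \<in> tilings_star \<mu>"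
  then obtain \<nu> \<nu>' where t: "dyck_tiling n \<mu> \<nu> P" "dyck_tiling n \<mu> \<nu>' Q" using tilings_star_iff[OF mu] by auto
  show "psi \<mu> P = psi \<mu> Q \<longleftrightarrow> P = Q"
  proof
    assume eq: "psi \<mu> P = psi \<mu> Q"
    show "P = Q"
    proof (rule tiling_determined[OF t])
      show "psi_label P (step_start \<mu> j) = psi_label Q (step_start \<mu> j)" if "j \<in> down_steps \<mu>" for j
        using that fun_cong[of _ _ j, OF arg_cong[of _ _ snd, OF eq]] by (simp add: psi_def)
    qed
  qed simp
next
  fix P assume "P \<in> tilings_star \<mu>"
  then obtain \<nu> where "dyck_tiling n \<mu> \<nu> P" using tilings_star_iff[OF mu] by auto
  then interpret dyck_tiling n \<mu> \<nu> P .
  have "psi_label P (step_start \<mu> j) < ht \<mu> j" if j: "j \<in> down_steps \<mu>" for j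
  proof -
    have "int j + 1 \<le> 2 * U \<mu> (int j)"
      using j dyck_pathsD(3)[OF mu, of "int j + 1"] dyck_pathsD(1)[OF mu] U_int_Suc[of j \<mu>]
      by (auto simp: down_steps_def)
    then have "0 < hgt (step_start \<mu> j)" using j by (auto simp: step_start_ed down_steps_def)
    then show ?thesis using psi_label_le_hgt ht_eq[OF mu j] by fastforce
  qed
  then show "psi \<mu> P \<in> HH \<mu>" by (auto simp: HH_def psi_def)
next
  fix h assume "h \<in> HH \<mu>"
  then obtain H where H: "h = (\<mu>, H)" "\<And>j. j \<in> down_steps \<mu> \<Longrightarrow> H j < ht \<mu> j"
    "\<And>j. j \<notin> down_steps \<mu> \<Longrightarrow> H j = 0" by (auto simp: HH_def)
  obtain \<nu> P where r: "realizes n \<mu> H \<nu> P" using realizes_exists[OF mu H(2)] by blast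
  then have "P \<in> tilings_star \<mu>" using tilings_star_iff[OF mu] by (auto simp: realizes_def)
  moreover have "h = psi \<mu> P" using r H by (auto simp: realizes_def psi_def)
  ultimately show "\<exists>P\<in>tilings_star \<mu>. h = psi \<mu> P" by blast
qed

lemma card_tiling:
  assumes mu: "\<mu> \<in> dyck_paths n" and "P \<in> tilings_star \<mu>"
  shows "card P = hh_norm \<mu> (snd (psi \<mu> P))"
proof -
  obtain \<nu> where "dyck_tiling n \<mu> \<nu> P" using tilings_star_iff[OF mu] assms(2) by auto
  then interpret dyck_tiling n \<mu> \<nu> P .
  show ?thesis by (simp add: card_P hh_norm_def psi_def)
qed

subsection \<open>Matchings and Hermite histories\<close>

text \<open>The position of \<open>i\<close> in \<open>A\<close> counted from the top, if
  \<open>A\<close> is seen as a stack filled in increasing order.\<close>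

definition depth_in :: "nat set \<Rightarrow> nat \<Rightarrow> nat" where
  "depth_in A i = card {i' \<in> A. i < i'}"

text \<open>Depth strictly decreases as the element grows and stays below the cardinality, so every
  value is taken once.\<close>

lemma depth_in_bij:
  assumes "finite A" shows "bij_betw (depth_in A) A {..<card A}"
proof -
  have less: "depth_in A j < depth_in A i" if "j \<in> A" "i < j" for i j
    unfolding depth_in_def by (rule psubset_card_mono) (use assms that in auto)
  have inj: "inj_on (depth_in A) A"
    by (rule inj_onI) (metis less less_irrefl linorder_neqE_nat)
  have "depth_in A i < card A" if "i \<in> A" for i
    unfolding depth_in_def by (rule psubset_card_mono) (use assms that in auto)
  then have "depth_in A ` A \<subseteq> {..<card A}" by auto
  then have "depth_in A ` A = {..<card A}"
    using card_image[OF inj] by (intro card_subset_eq) auto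
  with inj show ?thesis by (simp add: bij_betw_def)
qed

text \<open>The stack of open pairs before the step with list index \<open>k\<close>; that step is
  the element \<open>Suc k\<close> of the matching.\<close>

definition open_at :: "(nat \<times> nat) set \<Rightarrow> nat \<Rightarrow> nat set" where
  "open_at \<pi> k = {i. i \<le> k \<and> (\<exists>j>k. (i, j) \<in> \<pi>)}"

locale matching =
  fixes n :: nat and \<mu> :: "bool list" and \<pi> :: "(nat \<times> nat) set"
  assumes mu: "\<mu> \<in> dyck_paths n" and pi: "\<pi> \<in> matchings \<mu>"
begin

lemma len: "length \<mu> div 2 = n" "length \<mu> = 2 * n"
  using dyck_pathsD(1)[OF mu] by auto

lemma complete: "\<forall>(i, j)\<in>\<pi>. 1 \<le> i \<and> i < j \<and> j \<le> 2 * n"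
    "\<forall>k\<in>{1..2 * n}. \<exists>!p. p \<in> \<pi> \<and> (fst p = k \<or> snd p = k)" "shape n \<pi> = \<mu>"
  using pi[unfolded matchings_def complete_matching_def len(1) mem_Collect_eq] by - (elim conjE, assumption)+

lemma pair_bounds: "(i, j) \<in> \<pi> \<Longrightarrow> 1 \<le> i \<and> i < j \<and> j \<le> 2 * n"
  using bspec[OF complete(1)] by fastforce

lemma pair_unique:
  "p \<in> \<pi> \<Longrightarrow> q \<in> \<pi> \<Longrightarrow> fst p = k \<or> snd p = k \<Longrightarrow> fst q = k \<or> snd q = k \<Longrightarrow> p = q"
proof -
  assume *: "p \<in> \<pi>" "q \<in> \<pi>" "fst p = k \<or> snd p = k" "fst q = k \<or> snd q = k"
  then have "k \<in> {1..2 * n}" using pair_bounds[of "fst p" "snd p"] by auto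
  then have "\<exists>!p. p \<in> \<pi> \<and> (fst p = k \<or> snd p = k)"
    using complete(2) by blast
  then show ?thesis using * by blast
qed

lemma pair_exists: "k \<in> {1..2 * n} \<Longrightarrow> \<exists>p\<in>\<pi>. fst p = k \<or> snd p = k"
  using complete(2) by blast

lemma up_iff: "k < 2 * n \<Longrightarrow> \<mu> ! k \<longleftrightarrow> (\<exists>j. (Suc k, j) \<in> \<pi>)"
proof -
  assume k: "k < 2 * n"
  have "\<mu> = map (\<lambda>k. \<exists>j. (k, j) \<in> \<pi>) [1..<2 * n + 1]"
    using complete(3) unfolding shape_def by simp
  from arg_cong[OF this, of "\<lambda>l. l ! k"] k show ?thesis by (simp add: nth_map_upt del: upt_Suc)
qed

lemma down_partner: "k \<in> down_steps \<mu> \<Longrightarrow> \<exists>i. (i, Suc k) \<in> \<pi>"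
  using pair_exists[of "Suc k"] up_iff[of k] len by (fastforce simp: down_steps_def)

text \<open>The larger element of a pair cannot also be the smaller element of another one, so its
  step is not up.\<close>

lemma pair_snd: "(i, j) \<in> \<pi> \<Longrightarrow> \<exists>k\<in>down_steps \<mu>. j = Suc k"
proof -
  assume ij: "(i, j) \<in> \<pi>"
  then obtain k where k: "j = Suc k" using pair_bounds by (cases j) auto
  have "(Suc k, l) \<notin> \<pi>" for l using pair_unique[OF ij, of "(Suc k, l)" j] pair_bounds[OF ij] k by auto
  then have "\<not> \<mu> ! k" using up_iff[of k] pair_bounds[OF ij] k by auto
  then show ?thesis using k pair_bounds[OF ij] len by (auto simp: down_steps_def)
qed

lemma finite_open: "finite (open_at \<pi> k)"
  by (rule finite_subset[of _ "{..k}"]) (auto simp: open_at_def)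

lemma open_0: "open_at \<pi> 0 = {}"
  using pair_bounds by (fastforce simp: open_at_def)

lemma open_up: "k < 2 * n \<Longrightarrow> \<mu> ! k \<Longrightarrow> open_at \<pi> (Suc k) = insert (Suc k) (open_at \<pi> k)"
proof -
  assume k: "k < 2 * n" "\<mu> ! k"
  then obtain j where j: "(Suc k, j) \<in> \<pi>" using up_iff by blast
  have "(i, Suc k) \<notin> \<pi>" for i using pair_unique[OF j, of "(i, Suc k)" "Suc k"] pair_bounds[OF j] by auto
  then have gr: "Suc k < l" if "(i, l) \<in> \<pi>" "k < l" for i l
    using that by (metis Suc_lessI)
  show ?thesis
  proof (intro set_eqI iffI)
    fix i assume "i \<in> open_at \<pi> (Suc k)"
    then show "i \<in> insert (Suc k) (open_at \<pi> k)"
      by (auto simp: open_at_def le_Suc_eq intro: Suc_lessD)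
  next
    fix i assume "i \<in> insert (Suc k) (open_at \<pi> k)"
    then show "i \<in> open_at \<pi> (Suc k)" using j pair_bounds[OF j] gr
      by (auto simp: open_at_def intro: le_SucI)
  qed
qed

lemma open_down:
  assumes "(i, Suc k) \<in> \<pi>"
  shows "i \<in> open_at \<pi> k" "open_at \<pi> (Suc k) = open_at \<pi> k - {i}"
proof -
  show "i \<in> open_at \<pi> k" using assms pair_bounds[OF assms] by (auto simp: open_at_def)
  have 1: "(Suc k, j) \<notin> \<pi>" for j using pair_unique[OF assms, of "(Suc k, j)" "Suc k"] pair_bounds[OF assms] by auto
  have 2: "(i, j) \<in> \<pi> \<Longrightarrow> j = Suc k" for j using pair_unique[OF assms, of "(i, j)" i] by auto
  have 3: "(l, Suc k) \<in> \<pi> \<Longrightarrow> l = i" for l using pair_unique[OF assms, of "(l, Suc k)" "Suc k"] by auto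
  show "open_at \<pi> (Suc k) = open_at \<pi> k - {i}" (is "?l = ?r")
  proof
    show "?l \<subseteq> ?r"
    proof
      fix l assume "l \<in> ?l"
      then obtain j where j: "l \<le> Suc k" "Suc k < j" "(l, j) \<in> \<pi>" by (auto simp: open_at_def)
      then have "l \<noteq> Suc k" "l \<noteq> i" using 1 2 by auto
      then show "l \<in> ?r" using j by (auto simp: open_at_def intro!: exI[of _ j])
    qed
    show "?r \<subseteq> ?l"
    proof
      fix l assume "l \<in> ?r"
      then obtain j where j: "l \<le> k" "k < j" "(l, j) \<in> \<pi>" "l \<noteq> i" by (auto simp: open_at_def)
      then have "j \<noteq> Suc k" using 3 by auto
      then show "l \<in> ?l" using j by (auto simp: open_at_def intro: exI[of _ j])
    qed
  qed
qed

text \<open>The stack has as many elements as the path is high, so the labels allowed at a down step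
  are exactly the depths in the stack.\<close>

lemma card_open: "k \<le> 2 * n \<Longrightarrow> int (card (open_at \<pi> k)) = 2 * U \<mu> (int k) - int k"
proof (induction k)
  case 0
  show ?case by (simp add: open_0)
next
  case (Suc k)
  then have k: "k < 2 * n" by simp
  have U: "U \<mu> (int (Suc k)) = U \<mu> (int k) + (if \<mu> ! k then 1 else 0)"
    using U_int_Suc[of k \<mu>] k len by (simp add: add.commute)
  show ?case
  proof (cases "\<mu> ! k")
    case True
    have "Suc k \<notin> open_at \<pi> k" by (simp add: open_at_def)
    then show ?thesis using open_up[OF k True] Suc U True finite_open by simp
  next
    case False
    then have "k \<in> down_steps \<mu>" using k len by (simp add: down_steps_def)
    then obtain i where i: "(i, Suc k) \<in> \<pi>" using down_partner by blast
    have "card (open_at \<pi> k) = Suc (card (open_at \<pi> (Suc k)))"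
      using card.remove[OF finite_open open_down(1)[OF i]] open_down(2)[OF i] by simp
    then show ?thesis using Suc U False by simp
  qed
qed

text \<open>The pairs counted by \<open>zeta\<close> are those still open whose smaller element
  exceeds \<open>i\<close>, and each is determined by that element.\<close>

lemma zeta_label:
  assumes "(i, Suc k) \<in> \<pi>"
  shows "snd (zeta \<mu> \<pi>) k = depth_in (open_at \<pi> k) i"
proof -
  let ?A = "{(i', j') \<in> \<pi>. \<exists>i. (i, k + 1) \<in> \<pi> \<and> i < i' \<and> i' < k + 1 \<and> k + 1 < j'}"
  have k: "k \<in> down_steps \<mu>" using pair_snd[OF assms] by auto
  have 3: "(l, Suc k) \<in> \<pi> \<Longrightarrow> l = i" for l using pair_unique[OF assms, of "(l, Suc k)" "Suc k"] by auto
  have img: "fst ` ?A = {i' \<in> open_at \<pi> k. i < i'}"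
  proof
    show "fst ` ?A \<subseteq> {i' \<in> open_at \<pi> k. i < i'}"
    proof
      fix l assume "l \<in> fst ` ?A"
      then obtain j where j: "(l, j) \<in> \<pi>" "i < l" "l < k + 1" "k + 1 < j" using 3 by auto
      then show "l \<in> {i' \<in> open_at \<pi> k. i < i'}" by (auto simp: open_at_def intro!: exI[of _ j])
    qed
    show "{i' \<in> open_at \<pi> k. i < i'} \<subseteq> fst ` ?A"
    proof
      fix l assume "l \<in> {i' \<in> open_at \<pi> k. i < i'}"
      then obtain j where j: "l \<le> k" "k < j" "(l, j) \<in> \<pi>" "i < l" by (auto simp: open_at_def)
      then have "j \<noteq> Suc k" using 3 by auto
      then have "(l, j) \<in> ?A" using j assms by auto
      then show "l \<in> fst ` ?A" by force
    qed
  qed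
  have "inj_on fst ?A"
  proof (rule inj_onI)
    fix p q assume "p \<in> ?A" "q \<in> ?A" "fst p = fst q"
    then show "p = q" by (intro pair_unique[of p q "fst p"]) auto
  qed
  then have "card ?A = depth_in (open_at \<pi> k) i"
    unfolding depth_in_def img[symmetric] by (rule card_image[symmetric])
  then show ?thesis using k by (simp add: zeta_def)
qed

lemma zeta_HH: "zeta \<mu> \<pi> \<in> HH \<mu>"
proof -
  have "snd (zeta \<mu> \<pi>) k < ht \<mu> k" if k: "k \<in> down_steps \<mu>" for k
  proof -
    obtain i where i: "(i, Suc k) \<in> \<pi>" using down_partner[OF k] by blast
    have "depth_in (open_at \<pi> k) i < card (open_at \<pi> k)"
      using depth_in_bij[OF finite_open, of k] open_down(1)[OF i] unfolding bij_betw_def by blast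
    also have "int (card (open_at \<pi> k)) = int (ht \<mu> k)"
      using card_open[of k] ht_eq[OF mu k] k len by (simp add: down_steps_def step_start_ed)
    finally show ?thesis using zeta_label[OF i] by simp
  qed
  then show ?thesis by (auto simp: HH_def zeta_def)
qed

lemma finite_pi: "finite \<pi>"
proof (rule finite_subset)
  show "\<pi> \<subseteq> {..2 * n} \<times> {..2 * n}" using pair_bounds by fastforce
qed simp

text \<open>Every crossing is counted once, at the pair that closes first: the label of the down
  step closing \<open>p\<close> is the number of pairs \<open>q\<close> in
  \<open>?C p\<close>.\<close>

lemma cr_eq: "cr \<pi> = hh_norm \<mu> (snd (zeta \<mu> \<pi>))"
proof -
  let ?C = "\<lambda>p. {q \<in> \<pi>. fst p < fst q \<and> fst q < snd p \<and> snd p < snd q}"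
  let ?f = "\<lambda>(p, q). {p, q} :: (nat \<times> nat) set"
  have "{{p, q} | p q. p \<in> \<pi> \<and> q \<in> \<pi> \<and> fst p < fst q \<and> fst q < snd p \<and> snd p < snd q} =
    ?f ` (SIGMA p:\<pi>. ?C p)" by (force simp: image_iff simp del: split_paired_Ex)
  \<comment> \<open>The inequality \<open>fst p < fst q\<close> recovers the order of an unordered
    pair.\<close>
  moreover have "inj_on ?f (SIGMA p:\<pi>. ?C p)"
    by (rule inj_onI) (auto simp: doubleton_eq_iff)
  ultimately have "cr \<pi> = card (SIGMA p:\<pi>. ?C p)" unfolding cr_def by (simp add: card_image)
  also have "\<dots> = (\<Sum>p\<in>\<pi>. card (?C p))" using finite_pi by (intro card_SigmaI) auto
  also have "\<dots> = (\<Sum>k\<in>down_steps \<mu>. snd (zeta \<mu> \<pi>) k)"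
  proof (rule sum.reindex_bij_witness[of _ "\<lambda>k. (SOME i. (i, Suc k) \<in> \<pi>, Suc k)" "\<lambda>p. snd p - 1"])
    fix p assume p: "p \<in> \<pi>"
    then obtain i k where ik: "p = (i, Suc k)" "k \<in> down_steps \<mu>"
      using pair_snd[of "fst p" "snd p"] by (cases p) auto
    have u: "(l, Suc k) \<in> \<pi> \<Longrightarrow> l = i" for l
      using pair_unique[of p "(l, Suc k)" "Suc k"] p ik by auto
    have ikp: "(i, Suc k) \<in> \<pi>" using p ik by simp
    then have "(SOME i. (i, Suc k) \<in> \<pi>) = i" by (rule some_equality) (rule u)
    then show "(SOME i. (i, Suc (snd p - 1)) \<in> \<pi>, Suc (snd p - 1)) = p" using ik by simp
    show "snd p - 1 \<in> down_steps \<mu>" using ik by simp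
    have "{(i', j') \<in> \<pi>. \<exists>i. (i, k + 1) \<in> \<pi> \<and> i < i' \<and> i' < k + 1 \<and> k + 1 < j'} = ?C p"
    proof -
      have "(\<exists>l. (l, k + 1) \<in> \<pi> \<and> l < a \<and> a < k + 1 \<and> k + 1 < b) \<longleftrightarrow> i < a \<and> a < k + 1 \<and> k + 1 < b"
        for a b using u ikp by (metis Suc_eq_plus1)
      then show ?thesis by (simp add: ik(1) set_eq_iff)
    qed
    then show "snd (zeta \<mu> \<pi>) (snd p - 1) = card (?C p)" using ik by (simp add: zeta_def)
  next
    fix k assume "k \<in> down_steps \<mu>"
    then show "(SOME i. (i, Suc k) \<in> \<pi>, Suc k) \<in> \<pi>" using down_partner someI_ex by metis
  qed simp
  finally show ?thesis by (simp add: hh_norm_def)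
qed

end

text \<open>Both matchings have the same stack at every time: pushes are dictated by \<mu>, and at a
  down step equal depths in equal stacks pick the same partner.\<close>

lemma zeta_inj_on:
  assumes mu: "\<mu> \<in> dyck_paths n" shows "inj_on (zeta \<mu>) (matchings \<mu>)"
proof (rule inj_onI)
  fix \<pi> \<rho> assume "\<pi> \<in> matchings \<mu>" "\<rho> \<in> matchings \<mu>" and eq: "zeta \<mu> \<pi> = zeta \<mu> \<rho>"
  then interpret p: matching n \<mu> \<pi> + r: matching n \<mu> \<rho> using mu by unfold_locales
  have partner: "i = l" if "open_at \<pi> k = open_at \<rho> k" "(i, Suc k) \<in> \<pi>" "(l, Suc k) \<in> \<rho>" for i k l
    using depth_in_bij[OF p.finite_open, of k] that p.open_down(1)[of i k] r.open_down(1)[of l k]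
      p.zeta_label[of i k] r.zeta_label[of l k] eq unfolding bij_betw_def inj_on_def by simp
  have "open": "open_at \<pi> k = open_at \<rho> k" if "k \<le> 2 * n" for k
    using that
  proof (induction k)
    case (Suc k)
    show ?case
    proof (cases "\<mu> ! k")
      case True
      then show ?thesis using p.open_up[of k] r.open_up[of k] Suc by simp
    next
      case False
      then have "k \<in> down_steps \<mu>" using Suc p.len by (simp add: down_steps_def)
      then obtain i l where "(i, Suc k) \<in> \<pi>" "(l, Suc k) \<in> \<rho>"
        using p.down_partner r.down_partner by metis
      moreover from this have "i = l" using partner Suc by simp
      ultimately show ?thesis using p.open_down(2) r.open_down(2) Suc by simp
    qed
  qed (simp add: p.open_0 r.open_0)
  have "(i, j) \<in> \<pi> \<longleftrightarrow> (i, j) \<in> \<rho>" for i j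
  proof -
    have "\<exists>i. (i, Suc k) \<in> \<rho>" "\<exists>i. (i, Suc k) \<in> \<pi>" "k \<le> 2 * n" if "k \<in> down_steps \<mu>" for k
      using p.down_partner r.down_partner that p.len by (auto simp: down_steps_def)
    then show ?thesis using p.pair_snd[of i j] r.pair_snd[of i j] partner "open" by metis
  qed
  then show "\<pi> = \<rho>" by auto
qed

section \<open>Reconstructing a matching from a Hermite history\<close>

definition select :: "nat set \<Rightarrow> nat \<Rightarrow> nat" where
  "select A l = inv_into A (depth_in A) l"

lemma select:
  assumes "finite A" "l < card A"
  shows "select A l \<in> A" "depth_in A (select A l) = l"
  using depth_in_bij[OF assms(1)] assms(2) unfolding select_def bij_betw_def
  by (auto intro: inv_into_into f_inv_into_f)

text \<open>Simulates the stack: an up step pushes its own number, a down step removes the element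
  whose depth is its label.\<close>

primrec open_seq :: "bool list \<Rightarrow> (nat \<Rightarrow> nat) \<Rightarrow> nat \<Rightarrow> nat set" where
  "open_seq \<mu> H 0 = {}"
| "open_seq \<mu> H (Suc k) =
    (if \<mu> ! k then insert (Suc k) (open_seq \<mu> H k) else open_seq \<mu> H k - {select (open_seq \<mu> H k) (H k)})"

locale hermite =
  fixes n :: nat and \<mu> :: "bool list" and H :: "nat \<Rightarrow> nat"
  assumes mu: "\<mu> \<in> dyck_paths n" and label: "k \<in> down_steps \<mu> \<Longrightarrow> H k < ht \<mu> k"
begin

abbreviation "Op \<equiv> open_seq \<mu> H"
abbreviation "sel k \<equiv> select (Op k) (H k)"

lemma len: "length \<mu> div 2 = n" "length \<mu> = 2 * n"
  using dyck_pathsD(1)[OF mu] by auto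

lemma finite_Op: "finite (Op k)"
  by (induction k) auto

lemma Op_bounds: "i \<in> Op k \<Longrightarrow> 1 \<le> i \<and> i \<le> k \<and> \<mu> ! (i - 1)"
  by (induction k) (auto split: if_splits)

text \<open>Proved together: the stack size equals the height, so the label is a valid depth and
  \<open>select\<close> finds an element; its removal in turn maintains the size.\<close>

lemma card_Op: "k \<le> 2 * n \<Longrightarrow> int (card (Op k)) = 2 * U \<mu> (int k) - int k"
  and sel_Op: "k \<in> down_steps \<mu> \<Longrightarrow> sel k \<in> Op k \<and> depth_in (Op k) (sel k) = H k"
proof -
  have sel: "sel k \<in> Op k \<and> depth_in (Op k) (sel k) = H k"
    if "k \<in> down_steps \<mu>" "int (card (Op k)) = 2 * U \<mu> (int k) - int k" for k
  proof -
    have "int (H k) < int (ht \<mu> k)" using label[OF that(1)] by simp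
    also have "\<dots> = int (card (Op k))"
      using ht_eq[OF mu that(1)] that by (simp add: step_start_ed down_steps_def)
    finally show ?thesis using select[OF finite_Op] by simp
  qed
  show card: "k \<le> 2 * n \<Longrightarrow> int (card (Op k)) = 2 * U \<mu> (int k) - int k" for k
  proof (induction k)
    case (Suc k)
    have U: "U \<mu> (int (Suc k)) = U \<mu> (int k) + (if \<mu> ! k then 1 else 0)"
      using U_int_Suc[of k \<mu>] Suc.prems len by (simp add: add.commute)
    show ?case
    proof (cases "\<mu> ! k")
      case True
      have "Suc k \<notin> Op k" using Op_bounds[of "Suc k" k] by auto
      then show ?thesis using True Suc U finite_Op by simp
    next
      case False
      then have k: "sel k \<in> Op k" using sel[of k] Suc len by (simp add: down_steps_def)
      then have "card (Op k) = Suc (card (Op (Suc k)))"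
        using card.remove[OF finite_Op k] False by simp
      then show ?thesis using Suc U False by simp
    qed
  qed simp
  show "sel k \<in> Op k \<and> depth_in (Op k) (sel k) = H k" if "k \<in> down_steps \<mu>"
    using sel[OF that] card[of k] that len by (simp add: down_steps_def)
qed

definition pairing :: "(nat \<times> nat) set" where
  "pairing = (\<lambda>k. (sel k, Suc k)) ` down_steps \<mu>"

lemma Op_gone: "i \<notin> Op k \<Longrightarrow> i \<le> k \<Longrightarrow> k \<le> l \<Longrightarrow> i \<notin> Op l"
proof (induction l)
  case (Suc l)
  then show ?case by (cases "k \<le> l") (auto simp: le_Suc_eq split: if_splits)
qed simp

lemma Op_top: "Op (2 * n) = {}"
  using card_Op[of "2 * n"] dyck_pathsD(4)[OF mu, of "2 * int n"] finite_Op by simp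

text \<open>The stack is empty at the end, so \<open>Suc k\<close> leaves it at some time; the step
  before the first time it is missing is the down step that removes it.\<close>

lemma up_closes:
  assumes "k < 2 * n" "\<mu> ! k"
  shows "\<exists>l\<in>down_steps \<mu>. sel l = Suc k"
proof -
  let ?Q = "\<lambda>l. k < l \<and> Suc k \<notin> Op l"
  define l where "l = (LEAST l. ?Q l)"
  have "?Q (2 * n)" using assms Op_top by auto
  then have Q: "?Q l" and "l \<le> 2 * n" unfolding l_def by (rule LeastI, rule Least_le)
  have "l \<noteq> Suc k" using Q assms by auto
  then obtain l' where l': "l = Suc l'" "k < l'" using Q by (cases l) auto
  then have "Suc k \<in> Op l'" using not_less_Least[of l' ?Q] l_def by auto
  then have "\<not> \<mu> ! l' \<and> sel l' = Suc k" using Q l' by (auto split: if_splits)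
  then show ?thesis using l' \<open>l \<le> 2 * n\<close> len
    by (intro bexI[of _ l']) (auto simp: down_steps_def)
qed

text \<open>A removed element never returns, because only new, larger numbers are pushed.\<close>

lemma sel_inj: "k \<in> down_steps \<mu> \<Longrightarrow> l \<in> down_steps \<mu> \<Longrightarrow> sel k = sel l \<Longrightarrow> k = l"
proof -
  have "sel k \<noteq> sel l" if "k \<in> down_steps \<mu>" "l \<in> down_steps \<mu>" "k < l" for k l
  proof -
    have "sel k \<notin> Op (Suc k)" "sel k \<le> Suc k"
      using that sel_Op[of k] Op_bounds[of "sel k" k] by (auto simp: down_steps_def)
    then have "sel k \<notin> Op l" using Op_gone[of "sel k" "Suc k" l] that(3) by (simp del: open_seq.simps)
    then show ?thesis using sel_Op[OF that(2)] by auto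
  qed
  then show "k \<in> down_steps \<mu> \<Longrightarrow> l \<in> down_steps \<mu> \<Longrightarrow> sel k = sel l \<Longrightarrow> k = l"
    by (metis linorder_neqE_nat)
qed

lemma sel_up: "k \<in> down_steps \<mu> \<Longrightarrow> 1 \<le> sel k \<and> sel k \<le> k \<and> \<mu> ! (sel k - 1)"
  using sel_Op Op_bounds by blast

lemma pairing_matching: "pairing \<in> matchings \<mu>"
proof -
  have "\<exists>!p. p \<in> pairing \<and> (fst p = k \<or> snd p = k)" if k: "k \<in> {1..2 * n}" for k
  proof -
    obtain k' where k': "k = Suc k'" "k' < 2 * n" using k by (cases k) auto
    show ?thesis
    proof (cases "\<mu> ! k'")
      case True
      then obtain l where l: "l \<in> down_steps \<mu>" "sel l = k" using up_closes k' by blast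
      have "q = (sel l, Suc l)" if "q \<in> pairing" "fst q = k \<or> snd q = k" for q
        using that l sel_inj True k' by (auto simp: pairing_def down_steps_def)
      then show ?thesis using l by (intro ex1I[of _ "(sel l, Suc l)"]) (auto simp: pairing_def)
    next
      case False
      then have d: "k' \<in> down_steps \<mu>" using k' len by (simp add: down_steps_def)
      have "q = (sel k', Suc k')" if "q \<in> pairing" "fst q = k \<or> snd q = k" for q
      proof -
        obtain l where l: "l \<in> down_steps \<mu>" "q = (sel l, Suc l)" using \<open>q \<in> pairing\<close> by (auto simp: pairing_def)
        have "sel l \<noteq> k" using sel_up[OF l(1)] False k' by auto
        then show ?thesis using l that(2) k' by auto
      qed
      then show ?thesis using d k' by (intro ex1I[of _ "(sel k', Suc k')"]) (auto simp: pairing_def)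
    qed
  qed
  moreover have "1 \<le> i \<and> i < j \<and> j \<le> 2 * n" if "(i, j) \<in> pairing" for i j
    using that sel_up len by (fastforce simp: pairing_def down_steps_def)
  ultimately have "complete_matching n pairing" unfolding complete_matching_def by blast
  moreover have "shape n pairing = \<mu>"
  proof (rule nth_equalityI)
    fix k assume "k < length (shape n pairing)"
    then have k: "k < 2 * n" by (simp add: shape_def del: upt_Suc)
    then have "shape n pairing ! k \<longleftrightarrow> (\<exists>j. (Suc k, j) \<in> pairing)"
      by (simp add: shape_def nth_map_upt del: upt_Suc)
    also have "\<dots> \<longleftrightarrow> \<mu> ! k"
    proof
      assume "\<exists>j. (Suc k, j) \<in> pairing"
      then obtain l where l: "l \<in> down_steps \<mu>" "sel l = Suc k" unfolding pairing_def by auto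
      then show "\<mu> ! k" using sel_up[OF l(1)] by simp
    next
      assume "\<mu> ! k"
      then obtain l where l: "l \<in> down_steps \<mu>" "sel l = Suc k" using up_closes[OF k] by blast
      then show "\<exists>j. (Suc k, j) \<in> pairing" unfolding pairing_def by (intro exI image_eqI[OF _ l(1)]) simp
    qed
    finally show "shape n pairing ! k \<longleftrightarrow> \<mu> ! k" .
  qed (simp add: shape_def len)
  ultimately show ?thesis by (simp add: matchings_def len)
qed

sublocale m: matching n \<mu> pairing
  using mu pairing_matching by unfold_locales

lemma open_pairing: "k \<le> 2 * n \<Longrightarrow> open_at pairing k = Op k"
proof (induction k)
  case (Suc k)
  show ?case
  proof (cases "\<mu> ! k")
    case True
    then show ?thesis using m.open_up[of k] Suc by simp
  next
    case False
    then have "(sel k, Suc k) \<in> pairing" using Suc len by (auto simp: pairing_def down_steps_def)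
    then show ?thesis using m.open_down(2)[of "sel k" k] Suc False by simp
  qed
qed (simp add: m.open_0)

lemma zeta_pairing:
  assumes "k \<in> down_steps \<mu>" shows "snd (zeta \<mu> pairing) k = H k"
proof -
  have "(sel k, Suc k) \<in> pairing" using assms by (simp add: pairing_def)
  moreover have "open_at pairing k = Op k" using open_pairing assms len by (simp add: down_steps_def)
  ultimately show ?thesis using m.zeta_label[of "sel k" k] sel_Op[OF assms] by simp
qed

end

lemma zeta_bij:
  assumes mu: "\<mu> \<in> dyck_paths n"
  shows "bij_betw (zeta \<mu>) (matchings \<mu>) (HH \<mu>)"
  unfolding bij_betw_def
proof (intro conjI zeta_inj_on[OF mu] subset_antisym subsetI)
  fix h assume "h \<in> zeta \<mu> ` matchings \<mu>"
  then obtain \<pi> where \<pi>: "\<pi> \<in> matchings \<mu>" "h = zeta \<mu> \<pi>" by blast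
  interpret matching n \<mu> \<pi> using mu \<pi> by unfold_locales
  show "h \<in> HH \<mu>" using zeta_HH \<pi> by simp
next
  fix h assume "h \<in> HH \<mu>"
  then obtain H where H: "h = (\<mu>, H)" "\<And>j. j \<in> down_steps \<mu> \<Longrightarrow> H j < ht \<mu> j"
    "\<And>j. j \<notin> down_steps \<mu> \<Longrightarrow> H j = 0" by (auto simp: HH_def)
  interpret hermite n \<mu> H using mu H(2) by unfold_locales
  have "snd (zeta \<mu> pairing) k = H k" for k
    using zeta_pairing H(3) by (cases "k \<in> down_steps \<mu>") (auto simp: zeta_def)
  then have "zeta \<mu> pairing = h" using H(1) by (auto simp: zeta_def)
  then show "h \<in> zeta \<mu> ` matchings \<mu>" using pairing_matching by blast
qed

theorem theorem6p2:
  fixes n :: nat and \<mu> :: "bool list"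
  assumes "\<mu> \<in> dyck_paths n"
  shows "bij_betw (psi \<mu>) (tilings_star \<mu>) (HH \<mu>)
    \<and> (\<forall>T\<in>tilings_star \<mu>. card T = hh_norm \<mu> (snd (psi \<mu> T)))
    \<and> bij_betw (inv_into (matchings \<mu>) (zeta \<mu>) \<circ> psi \<mu>) (tilings_star \<mu>) (matchings \<mu>)
    \<and> (\<forall>T\<in>tilings_star \<mu>. card T = cr ((inv_into (matchings \<mu>) (zeta \<mu>) \<circ> psi \<mu>) T))"
proof (intro conjI ballI)
  let ?\<xi> = "inv_into (matchings \<mu>) (zeta \<mu>) \<circ> psi \<mu>"
  note psi = psi_bij[OF assms] and zeta = zeta_bij[OF assms]
  show "bij_betw (psi \<mu>) (tilings_star \<mu>) (HH \<mu>)" by (rule psi)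
  show comp: "bij_betw ?\<xi> (tilings_star \<mu>) (matchings \<mu>)"
    by (rule bij_betw_trans[OF psi bij_betw_inv_into[OF zeta]])
  fix T assume T: "T \<in> tilings_star \<mu>"
  show "card T = hh_norm \<mu> (snd (psi \<mu> T))" by (rule card_tiling[OF assms T])
  have "?\<xi> T \<in> matchings \<mu>" using comp T by (rule bij_betwE[THEN bspec])
  then interpret matching n \<mu> "?\<xi> T" using assms by unfold_locales
  \<comment> \<open>Tiles and crossings are now both counted by the norm of the same Hermite
    history.\<close>
  have "zeta \<mu> (?\<xi> T) = psi \<mu> T"
    using bij_betwE[OF psi] bij_betw_inv_into_right[OF zeta] T by simp
  then show "card T = cr (?\<xi> T)" using cr_eq card_tiling[OF assms T] by simp
qed

end
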